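(* Let $n\ge2$ and let $V=\mathbb C^n$ be regarded as a real manifold with complex structure $J$. For any classical $r$-matrix $\tilde r\in\bigwedge^2su(n)$ there is a constant $c$ such that $[\tilde r_V,\tilde r_V](z)=-c\|z\|^2Jz\wedge\pi_0$. The Poisson structures $\pi_V$ on $V$ for which the natural action of the Poisson Lie group $SU(n)$ (with Poisson structure $\pi(g)=\tilde rg-g\tilde r$) on $V$ is a Poisson action are exactly the bi-vector fields $$\pi_V=\tilde r_V+\Delta$$ such that the bi-vector field $\Delta$ on $V$ is $SU(n)$-invariant and satisfies $$[\Delta,\Delta](z)=c\|z\|^2Jz\wedge\pi_0 .$$
   Context: A classical $r$-matrix on $\mathfrak g$ is an $r\in\bigwedge^2\mathfrak g$ whose Schouten bracket $[r,r]\in\bigwedge^3\mathfrak g$ is $\mathfrak g$-invariant; then $\pi(g)=rg-gr$ (right minus left translation of $r$) is a Poisson Lie group structure. An action $G\times M\to M$ of a Poisson Lie group $(G,\pi)$ on a Poisson manifold $(M,\pi_M)$ is a Poisson action if the action map is Poisson, equivalently $\pi_M(gx)=\pi(g)x+g\pi_M(x)$ for all $g,x$. For $r=\sum_iX_i\wedge Y_i$ with $X_i,Y_i\in su(n)$, $r_V(z)=\sum_i(X_iz)\wedge(Y_iz)$. $\pi_0=2i\sum_k\partial_k\wedge\bar\partial_k$ with $\partial_k=\partial/\partial z^k$, $\bar\partial_k=\partial/\partial\bar z^k$; $Jz$ denotes the vector field $i\sum_k(z^k\partial_k-\bar z^k\bar\partial_k)$; $\|z\|^2=\sum_k|z^k|^2$.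 $[\cdot,\cdot]$ is the Schouten bracket, normalized by $[A\wedge B,C\wedge D]=[A,C]\wedge B\wedge D-[A,D]\wedge B\wedge C-[B,C]\wedge A\wedge D+[B,D]\wedge A\wedge C$. *)

theory Defs
  imports "HOL-Analysis.Analysis"
begin

section \<open>Multivectors\<close>

text \<open>For a finite-dimensional real vector space \<open>E\<close>, the spaces of bivectors and trivectors are
  identified with the alternating multilinear forms on the dual of \<open>E\<close>;
  on a finite-dimensional space every linear functional is a bounded one.\<close>

type_synonym 'a dual = "'a \<Rightarrow>\<^sub>L real"
type_synonym 'a bivec = "'a dual \<Rightarrow> 'a dual \<Rightarrow> real"
type_synonym 'a trivec = "'a dual \<Rightarrow> 'a dual \<Rightarrow> 'a dual \<Rightarrow> real"

definition bivector :: "'a::euclidean_space bivec \<Rightarrow> bool" where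
  "bivector b \<longleftrightarrow> bilinear b \<and> (\<forall>\<alpha>. b \<alpha> \<alpha> = 0)"

definition wedge2 :: "'a::euclidean_space \<Rightarrow> 'a \<Rightarrow> 'a bivec" where
  "wedge2 u v = (\<lambda>\<alpha> \<beta>. \<alpha> u * \<beta> v - \<beta> u * \<alpha> v)"

definition wedge12 :: "'a::euclidean_space \<Rightarrow> 'a bivec \<Rightarrow> 'a trivec" where
  "wedge12 u b = (\<lambda>\<alpha> \<beta> \<gamma>.
     blinfun_apply \<alpha> u * b \<beta> \<gamma> - blinfun_apply \<beta> u * b \<alpha> \<gamma> + blinfun_apply \<gamma> u * b \<alpha> \<beta>)"

definition wedge3 :: "'a::euclidean_space \<Rightarrow> 'a \<Rightarrow> 'a \<Rightarrow> 'a trivec" where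
  "wedge3 u v w = wedge12 u (wedge2 v w)"

definition pullcov :: "('a::euclidean_space \<Rightarrow> 'b::euclidean_space) \<Rightarrow> 'b dual \<Rightarrow> 'a dual" where
  "pullcov L \<alpha> = Blinfun (\<lambda>x. \<alpha> (L x))"

text \<open>The map induced on bivectors by a linear map \<open>L\<close>.\<close>

definition push2 :: "('a::euclidean_space \<Rightarrow> 'b::euclidean_space) \<Rightarrow> 'a bivec \<Rightarrow> 'b bivec" where
  "push2 L b = (\<lambda>\<alpha> \<beta>. b (pullcov L \<alpha>) (pullcov L \<beta>))"

section \<open>Schouten brackets\<close>

text \<open>The right-hand side of
  \<open>[A \<and> B, C \<and> D] = [A,C] \<and> B \<and> D - [A,D] \<and> B \<and> C - [B,C] \<and> A \<and> D + [B,D] \<and> A \<and> C\<close>,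
  with the Lie brackets passed as \<open>ac\<close>, \<open>ad\<close>, \<open>bc\<close>, \<open>bd\<close>.\<close>

definition schouten_rhs ::
  "'a::euclidean_space \<Rightarrow> 'a \<Rightarrow> 'a \<Rightarrow> 'a \<Rightarrow> 'a \<Rightarrow> 'a \<Rightarrow> 'a \<Rightarrow> 'a \<Rightarrow> 'a trivec" where
  "schouten_rhs ac ad bc bd a b c d = (\<lambda>\<alpha> \<beta> \<gamma>.
     wedge3 ac b d \<alpha> \<beta> \<gamma> - wedge3 ad b c \<alpha> \<beta> \<gamma> - wedge3 bc a d \<alpha> \<beta> \<gamma> + wedge3 bd a c \<alpha> \<beta> \<gamma>)"

definition lie_bracket ::
  "('a::euclidean_space \<Rightarrow> 'a) \<Rightarrow> ('a \<Rightarrow> 'a) \<Rightarrow> 'a \<Rightarrow> 'a" where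
  "lie_bracket A B z = frechet_derivative B (at z) (A z) - frechet_derivative A (at z) (B z)"

definition schouten_dec ::
  "('a::euclidean_space \<Rightarrow> 'a) \<Rightarrow> ('a \<Rightarrow> 'a) \<Rightarrow> ('a \<Rightarrow> 'a) \<Rightarrow> ('a \<Rightarrow> 'a) \<Rightarrow> 'a \<Rightarrow> 'a trivec" where
  "schouten_dec A B C D z =
     schouten_rhs (lie_bracket A C z) (lie_bracket A D z) (lie_bracket B C z) (lie_bracket B D z)
       (A z) (B z) (C z) (D z)"

abbreviation cob :: "'a::euclidean_space \<Rightarrow> 'a dual" where
  "cob i \<equiv> blinfun_inner_left i"

text \<open>Bilinear extension to arbitrary bivector fields, by means of the global decomposition
  \<open>\<pi> = 1/2 \<Sum>\<^sub>i\<^sub>j \<pi>\<^sup>i\<^sup>j \<partial>\<^sub>i \<and> \<partial>\<^sub>j\<close> in the standard coordinates; that the choice of the decomposition is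
  immaterial is lemma \<open>schouten_wedge2\<close> below.\<close>

definition schouten ::
  "('a::euclidean_space \<Rightarrow> 'a bivec) \<Rightarrow> ('a \<Rightarrow> 'a bivec) \<Rightarrow> 'a \<Rightarrow> 'a trivec" where
  "schouten \<pi> \<sigma> z = (\<lambda>\<alpha> \<beta> \<gamma>. 1/4 * (\<Sum>i\<in>Basis. \<Sum>j\<in>Basis. \<Sum>k\<in>Basis. \<Sum>l\<in>Basis.
     schouten_dec (\<lambda>x. \<pi> x (cob i) (cob j) *\<^sub>R i) (\<lambda>_. j) (\<lambda>x. \<sigma> x (cob k) (cob l) *\<^sub>R k) (\<lambda>_. l)
       z \<alpha> \<beta> \<gamma>))"

text \<open>The algebraic Schouten bracket on bivectors of the Lie algebra of all complex matrices; the
  one of a Lie subalgebra is its restriction (lemma \<open>alg_schouten_wedge2\<close>).\<close>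

definition commutator :: "complex^'n^'n \<Rightarrow> complex^'n^'n \<Rightarrow> complex^'n^'n" where
  "commutator X Y = X ** Y - Y ** X"

definition alg_schouten ::
  "(complex^'n^'n) bivec \<Rightarrow> (complex^'n^'n) bivec \<Rightarrow> (complex^'n^'n) trivec" where
  "alg_schouten r s = (\<lambda>\<alpha> \<beta> \<gamma>. 1/4 * (\<Sum>i\<in>Basis. \<Sum>j\<in>Basis. \<Sum>k\<in>Basis. \<Sum>l\<in>Basis.
     r (cob i) (cob j) * s (cob k) (cob l) *
     schouten_rhs (commutator i k) (commutator i l) (commutator j k) (commutator j l)
       i j k l \<alpha> \<beta> \<gamma>))"

section \<open>Poisson structures and Poisson maps\<close>

primrec Ck :: "nat \<Rightarrow> ('a::euclidean_space \<Rightarrow> real) \<Rightarrow> bool" where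
  "Ck 0 f \<longleftrightarrow> continuous_on UNIV f"
| "Ck (Suc k) f \<longleftrightarrow>
     f differentiable_on UNIV \<and> (\<forall>v. Ck k (\<lambda>x. frechet_derivative f (at x) v))"

definition smooth :: "('a::euclidean_space \<Rightarrow> real) \<Rightarrow> bool" where
  "smooth f \<longleftrightarrow> (\<forall>k. Ck k f)"

definition bivector_field :: "('a::euclidean_space \<Rightarrow> 'a bivec) \<Rightarrow> bool" where
  "bivector_field \<pi> \<longleftrightarrow> (\<forall>z. bivector (\<pi> z)) \<and> (\<forall>\<alpha> \<beta>. smooth (\<lambda>z. \<pi> z \<alpha> \<beta>))"

definition poisson_structure :: "('a::euclidean_space \<Rightarrow> 'a bivec) \<Rightarrow> bool" where
  "poisson_structure \<pi> \<longleftrightarrow> bivector_field \<pi> \<and> schouten \<pi> \<pi> = (\<lambda>z \<alpha> \<beta> \<gamma>. 0)"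

text \<open>\<open>S\<close> is a submanifold of the ambient space, \<open>\<pi>\<^sub>S\<close> is tangent to \<open>S\<close>, and the map on \<open>S\<close> is the
  restriction of \<open>\<phi>\<close>; by tangency the ambient derivative of \<open>\<phi>\<close> gives the right push-forward.\<close>

definition poisson_map_on ::
  "'a::euclidean_space set \<Rightarrow> ('a \<Rightarrow> 'a bivec) \<Rightarrow> ('b::euclidean_space \<Rightarrow> 'b bivec) \<Rightarrow> ('a \<Rightarrow> 'b) \<Rightarrow> bool"
  where "poisson_map_on S \<pi>\<^sub>S \<pi>\<^sub>N \<phi> \<longleftrightarrow>
    (\<forall>p\<in>S. push2 (frechet_derivative \<phi> (at p)) (\<pi>\<^sub>S p) = \<pi>\<^sub>N (\<phi> p))"

definition product_bivec ::
  "('a::euclidean_space \<Rightarrow> 'a bivec) \<Rightarrow> ('b::euclidean_space \<Rightarrow> 'b bivec) \<Rightarrow> 'a \<times> 'b \<Rightarrow> ('a \<times> 'b) bivec"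
  where "product_bivec \<pi>\<^sub>1 \<pi>\<^sub>2 p = (\<lambda>\<alpha> \<beta>.
    push2 (\<lambda>x. (x, 0)) (\<pi>\<^sub>1 (fst p)) \<alpha> \<beta> + push2 (\<lambda>y. (0, y)) (\<pi>\<^sub>2 (snd p)) \<alpha> \<beta>)"

section \<open>The special unitary group\<close>

definition cadjoint :: "complex^'n^'n \<Rightarrow> complex^'n^'n" where
  "cadjoint A = map_matrix cnj (transpose A)"

definition SU :: "(complex^'n^'n) set" where
  "SU = {g. g ** cadjoint g = mat 1 \<and> det g = 1}"

definition su :: "(complex^'n^'n) set" where
  "su = {X. cadjoint X = - X \<and> trace X = 0}"

definition wedge2_su :: "(complex^'n^'n) bivec set" where
  "wedge2_su = {r. \<exists>(N::nat) X Y. (\<forall>i<N. X i \<in> su \<and> Y i \<in> su) \<and>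
     r = (\<lambda>\<alpha> \<beta>. \<Sum>i<N. wedge2 (X i) (Y i) \<alpha> \<beta>)}"

definition su_invariant :: "(complex^'n^'n) trivec \<Rightarrow> bool" where
  "su_invariant T \<longleftrightarrow> (\<forall>X\<in>su. \<forall>\<alpha> \<beta> \<gamma>.
     T (pullcov (commutator X) \<alpha>) \<beta> \<gamma> + T \<alpha> (pullcov (commutator X) \<beta>) \<gamma>
       + T \<alpha> \<beta> (pullcov (commutator X) \<gamma>) = 0)"

definition classical_r_matrix :: "(complex^'n^'n) bivec \<Rightarrow> bool" where
  "classical_r_matrix r \<longleftrightarrow> r \<in> wedge2_su \<and> su_invariant (alg_schouten r r)"

definition pi_group :: "(complex^'n^'n) bivec \<Rightarrow> complex^'n^'n \<Rightarrow> (complex^'n^'n) bivec" where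
  "pi_group r g = (\<lambda>\<alpha> \<beta>. push2 (\<lambda>X. X ** g) r \<alpha> \<beta> - push2 (\<lambda>X. g ** X) r \<alpha> \<beta>)"

definition poisson_action_SU ::
  "(complex^'n^'n \<Rightarrow> (complex^'n^'n) bivec) \<Rightarrow> (complex^'n \<Rightarrow> (complex^'n) bivec) \<Rightarrow> bool" where
  "poisson_action_SU \<pi>\<^sub>G \<pi>\<^sub>V \<longleftrightarrow>
     poisson_map_on (SU \<times> UNIV) (product_bivec \<pi>\<^sub>G \<pi>\<^sub>V) \<pi>\<^sub>V (\<lambda>(g, z). g *v z)"

definition SU_invariant_field :: "(complex^'n \<Rightarrow> (complex^'n) bivec) \<Rightarrow> bool" where
  "SU_invariant_field \<Delta> \<longleftrightarrow> (\<forall>g\<in>SU. \<forall>z. \<Delta> (g *v z) = push2 (\<lambda>v. g *v v) (\<Delta> z))"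

text \<open>For \<open>r = \<Sum> X\<^sub>i \<and> Y\<^sub>i\<close> this is \<open>\<Sum> (X\<^sub>i z) \<and> (Y\<^sub>i z)\<close> (lemma \<open>r_V_sum_wedge2\<close>).\<close>

definition r_V :: "(complex^'n^'n) bivec \<Rightarrow> complex^'n \<Rightarrow> (complex^'n) bivec" where
  "r_V r z = push2 (\<lambda>X. X *v z) r"

section \<open>The standard structures on complex space\<close>

text \<open>\<open>\<partial>/\<partial>z\<^sup>k\<close> and its conjugate, as complexified tangent vectors acting on real covectors.\<close>

definition dz :: "'n::finite \<Rightarrow> (complex^'n) dual \<Rightarrow> complex" where
  "dz k \<alpha> = (of_real (\<alpha> (axis k 1)) - \<i> * of_real (\<alpha> (axis k \<i>))) / 2"

definition dzbar :: "'n::finite \<Rightarrow> (complex^'n) dual \<Rightarrow> complex" where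
  "dzbar k \<alpha> = (of_real (\<alpha> (axis k 1)) + \<i> * of_real (\<alpha> (axis k \<i>))) / 2"

definition pi0 :: "(complex^'n) bivec" where
  "pi0 = (\<lambda>\<alpha> \<beta>. Re (2 * \<i> * (\<Sum>k\<in>UNIV. dz k \<alpha> * dzbar k \<beta> - dz k \<beta> * dzbar k \<alpha>)))"

definition J :: "complex^'n \<Rightarrow> complex^'n" where
  "J z = \<i> *s z"

section \<open>Consistency of the definitions\<close>

lemma dual_sum: "blinfun_apply (\<alpha>::'a::euclidean_space dual) (\<Sum>i\<in>A. f i) = (\<Sum>i\<in>A. \<alpha> (f i))"
  by (rule linear_sum) (simp add: bounded_linear.linear blinfun.bounded_linear_right)

lemma dual_vec:
  fixes \<alpha> :: "(complex^'n) dual"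
  shows "\<alpha> v = (\<Sum>k\<in>UNIV. Re (v $ k) * \<alpha> (axis k 1) + Im (v $ k) * \<alpha> (axis k \<i>))"
proof -
  have *: "axis k c = Re c *\<^sub>R axis k 1 + Im c *\<^sub>R axis k \<i>" for k :: 'n and c :: complex
    by (auto simp: vec_eq_iff axis_def complex_eq_iff)
  have "v = (\<Sum>k\<in>UNIV. axis k (v $ k))"
    by (auto simp: vec_eq_iff axis_def sum.delta if_distrib cong: if_cong)
  then have "v = (\<Sum>k\<in>UNIV. Re (v $ k) *\<^sub>R axis k 1 + Im (v $ k) *\<^sub>R axis k \<i>)"
    by (simp flip: *)
  then have "\<alpha> v = \<alpha> (\<Sum>k\<in>UNIV. Re (v $ k) *\<^sub>R axis k 1 + Im (v $ k) *\<^sub>R axis k \<i>)"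
    by simp
  then show ?thesis
    by (simp add: dual_sum blinfun.add_right blinfun.scaleR_right)
qed

lemma pi0_complex:
  "complex_of_real (pi0 \<alpha> \<beta>) =
     2 * \<i> * (\<Sum>k\<in>UNIV. dz k \<alpha> * dzbar k \<beta> - dz k \<beta> * dzbar k \<alpha>)"
  unfolding pi0_def
  by (rule complex_eqI)
    (auto simp: dz_def dzbar_def algebra_simps intro!: sum.neutral)

lemma pi0_real: "pi0 \<alpha> \<beta> = - (\<Sum>k\<in>UNIV. wedge2 (axis k 1) (axis k \<i>) \<alpha> \<beta>)"
proof -
  have "pi0 \<alpha> \<beta> = (\<Sum>k\<in>UNIV. Re (2 * \<i> * (dz k \<alpha> * dzbar k \<beta> - dz k \<beta> * dzbar k \<alpha>)))"
    unfolding pi0_def sum_distrib_left Re_sum ..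
  also have "\<dots> = (\<Sum>k\<in>UNIV. - wedge2 (axis k 1) (axis k \<i>) \<alpha> \<beta>)"
    by (rule sum.cong) (simp_all add: dz_def dzbar_def wedge2_def field_simps)
  finally show ?thesis
    by (simp add: sum_negf)
qed

lemma J_complex:
  "complex_of_real (blinfun_apply \<alpha> (J z)) =
     \<i> * (\<Sum>k\<in>UNIV. z $ k * dz k \<alpha> - cnj (z $ k) * dzbar k \<alpha>)"
  unfolding dual_vec[of \<alpha> "J z"] sum_distrib_left of_real_sum
  by (rule sum.cong) (auto simp: J_def dz_def dzbar_def complex_eq_iff field_simps)

lemma pullcov_apply:
  assumes "linear L"
  shows "blinfun_apply (pullcov L \<alpha>) x = \<alpha> (L x)"
proof -
  have "bounded_linear (\<lambda>x. blinfun_apply \<alpha> (L x))"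
    using assms by (intro blinfun.bounded_linear_right[THEN bounded_linear_compose])
      (simp add: linear_conv_bounded_linear)
  then show ?thesis
    by (simp add: pullcov_def bounded_linear_Blinfun_apply)
qed

lemma push2_wedge2:
  assumes "linear L"
  shows "push2 L (wedge2 u v) = wedge2 (L u) (L v)"
  by (simp add: push2_def wedge2_def pullcov_apply[OF assms])

lemma linear_matrix_vector_left: "linear (\<lambda>X::complex^'n^'m. X *v z)"
  by (rule linearI) (auto simp: matrix_vector_mult_def vec_eq_iff algebra_simps sum.distrib
      scaleR_sum_right)

lemma linear_matrix_vector_right: "linear (\<lambda>z::complex^'n. (g::complex^'n^'m) *v z)"
  by (rule linearI) (auto simp: matrix_vector_mult_def vec_eq_iff algebra_simps sum.distrib
      scaleR_sum_right)

lemma r_V_sum_wedge2: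
  "r_V (\<lambda>\<alpha> \<beta>. \<Sum>i<(N::nat). wedge2 (X i) (Y i) \<alpha> \<beta>) z
     = (\<lambda>\<alpha> \<beta>. \<Sum>i<N. wedge2 (X i *v z) (Y i *v z) \<alpha> \<beta>)"
  by (simp add: r_V_def push2_def wedge2_def pullcov_apply[OF linear_matrix_vector_left])

lemma poisson_action_SU_iff:
  "poisson_action_SU \<pi>\<^sub>G \<pi>\<^sub>V \<longleftrightarrow>
    (\<forall>g\<in>SU. \<forall>z. \<pi>\<^sub>V (g *v z) =
       (\<lambda>\<alpha> \<beta>. push2 (\<lambda>X. X *v z) (\<pi>\<^sub>G g) \<alpha> \<beta> + push2 (\<lambda>v. g *v v) (\<pi>\<^sub>V z) \<alpha> \<beta>))"
proof -
  let ?\<phi> = "\<lambda>p::(complex^'a^'a) \<times> (complex^'a). fst p *v snd p"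
  have bb: "bounded_bilinear (\<lambda>(g::complex^'a^'a) z. g *v z)"
    unfolding bilinear_conv_bounded_bilinear[symmetric] bilinear_def
    by (simp add: linear_matrix_vector_left linear_matrix_vector_right)
  have hd: "(?\<phi> has_derivative (\<lambda>q. g *v snd q + fst q *v z)) (at (g, z))" for g z
    using bounded_bilinear.FDERIV[OF bb has_derivative_fst[OF has_derivative_ident]
        has_derivative_snd[OF has_derivative_ident], of "(g, z)" UNIV] by simp
  then have D: "frechet_derivative ?\<phi> (at (g, z)) = (\<lambda>q. g *v snd q + fst q *v z)" for g z
    by (rule frechet_derivative_at[symmetric])
  have L: "linear (\<lambda>q. g *v snd q + fst q *v z)" for g :: "complex^'a^'a" and z :: "complex^'a"
    by (rule has_derivative_linear[OF hd])
  have L1: "linear (\<lambda>X::complex^'a^'a. (X, 0::complex^'a))"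
    and L2: "linear (\<lambda>v::complex^'a. (0::complex^'a^'a, v))"
    by (auto intro!: linearI)
  have 1: "pullcov (\<lambda>X. (X, 0)) (pullcov (\<lambda>q. g *v snd q + fst q *v z) \<alpha>) = pullcov (\<lambda>X. X *v z) \<alpha>"
    and 2: "pullcov (\<lambda>v. (0, v)) (pullcov (\<lambda>q. g *v snd q + fst q *v z) \<alpha>) = pullcov (\<lambda>v. g *v v) \<alpha>"
    for g :: "complex^'a^'a" and z :: "complex^'a" and \<alpha>
    by (rule blinfun_eqI, simp add: pullcov_apply[OF L] pullcov_apply[OF L1] pullcov_apply[OF L2]
        pullcov_apply[OF linear_matrix_vector_left] pullcov_apply[OF linear_matrix_vector_right])+
  have e: "(\<lambda>(g::complex^'a^'a, z). g *v z) = ?\<phi>"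
    by auto
  have P: "push2 (frechet_derivative ?\<phi> (at (g, z))) (product_bivec \<pi>\<^sub>G \<pi>\<^sub>V (g, z)) =
      (\<lambda>\<alpha> \<beta>. push2 (\<lambda>X. X *v z) (\<pi>\<^sub>G g) \<alpha> \<beta> + push2 (\<lambda>v. g *v v) (\<pi>\<^sub>V z) \<alpha> \<beta>)" for g z
    unfolding D push2_def product_bivec_def 1 2 fst_conv snd_conv ..
  have "poisson_action_SU \<pi>\<^sub>G \<pi>\<^sub>V \<longleftrightarrow> (\<forall>g\<in>SU. \<forall>z.
      push2 (frechet_derivative ?\<phi> (at (g, z))) (product_bivec \<pi>\<^sub>G \<pi>\<^sub>V (g, z)) = \<pi>\<^sub>V (g *v z))"
    unfolding poisson_action_SU_def poisson_map_on_def e Ball_def mem_Times_iff split_paired_all split_paired_All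
    by simp
  then show ?thesis
    unfolding P by (simp only: eq_commute[of "\<pi>\<^sub>V _"])
qed

text \<open>Both brackets are bilinear, hence determined by their values on decomposable bivectors.\<close>

lemma alg_schouten_wedge2:
  "alg_schouten (wedge2 A B) (wedge2 C D) =
     schouten_rhs (commutator A C) (commutator A D) (commutator B C) (commutator B D) A B C D"
proof (intro ext)
  fix \<alpha> \<beta> \<gamma> :: "(complex^'a^'a) dual"
  define F where "F a b c d = schouten_rhs (commutator a c) (commutator a d) (commutator b c)
    (commutator b d) a b c d \<alpha> \<beta> \<gamma>" for a b c d
  have bl: "bilinear (commutator :: complex^'a^'a \<Rightarrow> _)"
    unfolding bilinear_def
    by (auto intro!: linearI simp: commutator_def matrix_matrix_mult_def vec_eq_iff algebra_simps
        sum.distrib scaleR_sum_right)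
  note simps = F_def schouten_rhs_def wedge3_def wedge12_def wedge2_def
  have swap: "F a b c d = F c d a b" and anti: "F a b c d = - F b a c d" for a b c d
  proof -
    have c: "commutator x y = - commutator y x" for x y :: "complex^'a^'a"
      by (simp add: commutator_def)
    show "F a b c d = F c d a b"
      unfolding simps c[of c a] c[of d a] c[of c b] c[of d b]
      by (simp add: blinfun.minus_right algebra_simps)
    show "F a b c d = - F b a c d"
      unfolding simps by (simp add: algebra_simps)
  qed
  have lin: "linear (\<lambda>a. F a b c d)" for b c d
    unfolding simps
    by (rule linearI) (simp_all add: blinfun.add_right blinfun.scaleR_right bilinear_ladd[OF bl]
        bilinear_lmul[OF bl] algebra_simps)
  have half: "(\<Sum>i\<in>Basis. \<Sum>j\<in>Basis. wedge2 a b (cob i) (cob j) * F i j c d) = 2 * F a b c d" for a b c d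
  proof -
    have e1: "F a b c d = (\<Sum>i\<in>Basis. (a \<bullet> i) * F i b c d)" for a b c d
    proof -
      have "F a b c d = F (\<Sum>i\<in>Basis. (a \<bullet> i) *\<^sub>R i) b c d"
        by (simp add: euclidean_representation)
      also have "\<dots> = (\<Sum>i\<in>Basis. F ((a \<bullet> i) *\<^sub>R i) b c d)"
        by (rule linear_sum[OF lin])
      finally show ?thesis
        by (simp add: linear_scale[OF lin])
    qed
    have e2: "F a b c d = (\<Sum>i\<in>Basis. \<Sum>j\<in>Basis. (a \<bullet> i) * (b \<bullet> j) * F i j c d)" for a b c d
    proof -
      have "F i b c d = (\<Sum>j\<in>Basis. (b \<bullet> j) * F i j c d)" for i
        using e1[of b i c d] by (simp add: anti[of _ i] sum_negf)
      then show ?thesis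
        by (subst e1) (simp add: sum_distrib_left mult.assoc)
    qed
    have "(\<Sum>i\<in>Basis. \<Sum>j\<in>Basis. (a \<bullet> j) * (b \<bullet> i) * F i j c d) = F b a c d"
      by (simp add: e2[of b a] mult.commute)
    then show ?thesis
      using e2[of a b c d] anti[of a b c d]
      by (simp add: wedge2_def left_diff_distrib sum_subtractf)
  qed
  have "alg_schouten (wedge2 A B) (wedge2 C D) \<alpha> \<beta> \<gamma> = 1/4 * (\<Sum>i\<in>Basis. \<Sum>j\<in>Basis.
      wedge2 A B (cob i) (cob j) * (\<Sum>k\<in>Basis. \<Sum>l\<in>Basis. wedge2 C D (cob k) (cob l) * F k l i j))"
    unfolding alg_schouten_def F_def[symmetric] sum_distrib_left mult.assoc
    by (subst swap) (rule refl)
  also have "\<dots> = 1/2 * (\<Sum>i\<in>Basis. \<Sum>j\<in>Basis. wedge2 A B (cob i) (cob j) * F i j C D)"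
    unfolding half[of C D] swap[of C D] by (simp add: sum_distrib_left mult_ac)
  also have "\<dots> = F A B C D"
    unfolding half by simp
  finally show "alg_schouten (wedge2 A B) (wedge2 C D) \<alpha> \<beta> \<gamma> =
     schouten_rhs (commutator A C) (commutator A D) (commutator B C) (commutator B D) A B C D \<alpha> \<beta> \<gamma>"
    by (simp add: F_def)
qed

lemma schouten_wedge2:
  assumes diff: "A differentiable at z" "B differentiable at z"
    "C differentiable at z" "D differentiable at z"
  shows "schouten (\<lambda>x. wedge2 (A x) (B x)) (\<lambda>x. wedge2 (C x) (D x)) z = schouten_dec A B C D z"
proof (intro ext)
  fix \<alpha> \<beta> \<gamma> :: "'a dual"
  define F where "F a a' b b' c c' d d' =
    schouten_rhs (c' a - a' c) (d' a - a' d) (c' b - b' c) (d' b - b' d) a b c d \<alpha> \<beta> \<gamma>"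
    for a b c d and a' b' c' d' :: "'a \<Rightarrow> 'a"
  note simps = F_def schouten_rhs_def wedge3_def wedge12_def wedge2_def
  have swap: "F a a' b b' c c' d d' = F c c' d d' a a' b b'"
    and anti: "F a a' b b' c c' d d' = - F b b' a a' c c' d d'" for a a' b b' c c' d d'
    unfolding simps by (simp_all add: blinfun.diff_right algebra_simps)
  have add: "F (a + e) (\<lambda>v. a' v + e' v) b b' c c' d d' = F a a' b b' c c' d d' + F e e' b b' c c' d d'"
    if "linear c'" "linear d'" for a a' b b' c c' d d' e e'
    unfolding simps linear_add[OF that(1)] linear_add[OF that(2)]
    by (simp add: blinfun.add_right blinfun.diff_right algebra_simps)
  have zero: "F 0 (\<lambda>v. 0) b b' c c' d d' = 0" if "linear c'" "linear d'" for b b' c c' d d'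
    unfolding simps linear_0[OF that(1)] linear_0[OF that(2)] by simp
  have sum: "F (\<Sum>i\<in>I. f i) (\<lambda>v. \<Sum>i\<in>I. f' i v) b b' c c' d d' = (\<Sum>i\<in>I. F (f i) (f' i) b b' c c' d d')"
    if "linear c'" "linear d'" "finite I" for b b' c c' d d' f f' and I :: "'a set"
    using that(3) by induction (simp_all add: zero[OF that(1,2)] add[OF that(1,2)])
  have juggle: "F (f *\<^sub>R a) (\<lambda>v. f' v *\<^sub>R a + f *\<^sub>R a' v) b b' c c' d d' =
     F a a' (f *\<^sub>R b) (\<lambda>v. f' v *\<^sub>R b + f *\<^sub>R b' v) c c' d d'"
    if "linear c'" "linear d'" for f f' a a' b b' c c' d d'
    unfolding simps linear_scale[OF that(1)] linear_scale[OF that(2)]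
    by (simp add: blinfun.add_right blinfun.scaleR_right blinfun.diff_right algebra_simps)
  have juggle0: "F (f *\<^sub>R a) (\<lambda>v. f' v *\<^sub>R a) b (\<lambda>v. 0) c c' d d' =
     F a (\<lambda>v. 0) (f *\<^sub>R b) (\<lambda>v. f' v *\<^sub>R b) c c' d d'"
    if "linear c'" "linear d'" for f f' a b c c' d d'
    using juggle[OF that, of f a f' "\<lambda>v. 0" b "\<lambda>v. 0"] by simp
  let ?W' = "\<lambda>a a' b b' i j v. (a' v \<bullet> i) * (b \<bullet> j) + (a \<bullet> i) * (b' v \<bullet> j)
       - ((a' v \<bullet> j) * (b \<bullet> i) + (a \<bullet> j) * (b' v \<bullet> i))"
  have half: "(\<Sum>i\<in>Basis. \<Sum>j\<in>Basis. F (wedge2 a b (cob i) (cob j) *\<^sub>R i)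
     (\<lambda>v. ?W' a a' b b' i j v *\<^sub>R i) j (\<lambda>v. 0) c c' d d') = 2 * F a a' b b' c c' d d'"
    if l: "linear c'" "linear d'" for a a' b b' c c' d d'
  proof -
    have e1: "F a a' b b' c c' d d' =
        (\<Sum>i\<in>Basis. F ((a \<bullet> i) *\<^sub>R i) (\<lambda>v. (a' v \<bullet> i) *\<^sub>R i) b b' c c' d d')" for a a' b b'
      using sum[OF l finite_Basis, of "\<lambda>i. (a \<bullet> i) *\<^sub>R i" "\<lambda>i v. (a' v \<bullet> i) *\<^sub>R i"]
      by (simp add: euclidean_representation)
    have e2: "F a a' b b' c c' d d' = (\<Sum>i\<in>Basis. \<Sum>j\<in>Basis.
        F (((a \<bullet> i) * (b \<bullet> j)) *\<^sub>R i) (\<lambda>v. ((a' v \<bullet> i) * (b \<bullet> j) + (a \<bullet> i) * (b' v \<bullet> j)) *\<^sub>R i)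
          j (\<lambda>v. 0) c c' d d')" for a a' b b'
    proof -
      have "F ((a \<bullet> i) *\<^sub>R i) (\<lambda>v. (a' v \<bullet> i) *\<^sub>R i) b b' c c' d d' = (\<Sum>j\<in>Basis.
        F (((a \<bullet> i) * (b \<bullet> j)) *\<^sub>R i) (\<lambda>v. ((a' v \<bullet> i) * (b \<bullet> j) + (a \<bullet> i) * (b' v \<bullet> j)) *\<^sub>R i)
          j (\<lambda>v. 0) c c' d d')" for i
      proof -
        have "F ((a \<bullet> i) *\<^sub>R i) (\<lambda>v. (a' v \<bullet> i) *\<^sub>R i) b b' c c' d d' =
           F i (\<lambda>v. 0) ((a \<bullet> i) *\<^sub>R b) (\<lambda>v. (a' v \<bullet> i) *\<^sub>R b + (a \<bullet> i) *\<^sub>R b' v) c c' d d'"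
          using juggle[OF l, of "a \<bullet> i" i "\<lambda>v. a' v \<bullet> i" "\<lambda>v. 0" b b'] by simp
        also have "\<dots> = (\<Sum>j\<in>Basis. F i (\<lambda>v. 0) (((a \<bullet> i) * (b \<bullet> j)) *\<^sub>R j)
            (\<lambda>v. ((a' v \<bullet> i) * (b \<bullet> j) + (a \<bullet> i) * (b' v \<bullet> j)) *\<^sub>R j) c c' d d')"
          by (subst anti, subst e1) (simp add: anti[of i] sum_negf inner_add_left)
        finally show ?thesis
          by (simp add: juggle0[OF l])
      qed
      then show ?thesis
        by (subst e1) simp
    qed
    have sub: "F ((f - g) *\<^sub>R i) (\<lambda>v. (f' v - g' v) *\<^sub>R i) j (\<lambda>v. 0) c c' d d' =
       F (f *\<^sub>R i) (\<lambda>v. f' v *\<^sub>R i) j (\<lambda>v. 0) c c' d d' +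
       F (g *\<^sub>R j) (\<lambda>v. g' v *\<^sub>R j) i (\<lambda>v. 0) c c' d d'" for f g f' g' i j
    proof -
      have "F (f *\<^sub>R i) (\<lambda>v. f' v *\<^sub>R i) j (\<lambda>v. 0) c c' d d' =
         F ((f - g) *\<^sub>R i) (\<lambda>v. (f' v - g' v) *\<^sub>R i) j (\<lambda>v. 0) c c' d d' +
         F (g *\<^sub>R i) (\<lambda>v. g' v *\<^sub>R i) j (\<lambda>v. 0) c c' d d'"
        by (subst add[OF l, symmetric]) (simp add: algebra_simps)
      moreover have "F (g *\<^sub>R i) (\<lambda>v. g' v *\<^sub>R i) j (\<lambda>v. 0) c c' d d' =
         - F (g *\<^sub>R j) (\<lambda>v. g' v *\<^sub>R j) i (\<lambda>v. 0) c c' d d'"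
        by (subst juggle0[OF l], subst anti) simp
      ultimately show ?thesis by simp
    qed
    have "(\<Sum>i\<in>Basis. \<Sum>j\<in>Basis. F (wedge2 a b (cob i) (cob j) *\<^sub>R i)
       (\<lambda>v. ?W' a a' b b' i j v *\<^sub>R i) j (\<lambda>v. 0) c c' d d') = F a a' b b' c c' d d' +
       (\<Sum>i\<in>Basis. \<Sum>j\<in>Basis. F (((a \<bullet> j) * (b \<bullet> i)) *\<^sub>R j)
          (\<lambda>v. ((a' v \<bullet> j) * (b \<bullet> i) + (a \<bullet> j) * (b' v \<bullet> i)) *\<^sub>R j) i (\<lambda>v. 0) c c' d d')"
      by (simp add: wedge2_def sub sum.distrib e2[of a a' b b'] mult.commute[of "a \<bullet> _" "b \<bullet> _"])
    also have "\<dots> = 2 * F a a' b b' c c' d d'"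
      by (subst sum.swap) (simp add: e2[of a a' b b', symmetric])
    finally show ?thesis .
  qed
  let ?d = "\<lambda>f. frechet_derivative f (at z)"
  have hd: "(f has_derivative ?d f) (at z)" if "f differentiable at z" for f :: "'a \<Rightarrow> 'a"
    using that by (simp add: frechet_derivative_works)
  have lin: "linear (?d f)" if "f differentiable at z" for f :: "'a \<Rightarrow> 'a"
    using hd[OF that] by (rule has_derivative_linear)
  have dW: "?d (\<lambda>x. wedge2 (f x) (g x) (cob i) (cob j) *\<^sub>R i) =
      (\<lambda>v. ?W' (f z) (?d f) (g z) (?d g) i j v *\<^sub>R i)"
    if "f differentiable at z" "g differentiable at z" for f g :: "'a \<Rightarrow> 'a" and i j
    unfolding wedge2_def blinfun_inner_left.rep_eq
    by (rule frechet_derivative_at[symmetric])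
      (auto intro!: derivative_eq_intros hd that simp: algebra_simps)
  have lW: "linear (\<lambda>v. ?W' (f z) (?d f) (g z) (?d g) i j v *\<^sub>R i)"
    if "f differentiable at z" "g differentiable at z" for f g :: "'a \<Rightarrow> 'a" and i j
    using lin[OF that(1)] lin[OF that(2)]
    by (intro linearI) (simp_all add: linear_add linear_scale inner_add_left algebra_simps)
  have l0: "linear (\<lambda>v::'a. 0::'a)"
    by (rule module_hom_zero)
  have F: "schouten_dec A B C D z \<alpha> \<beta> \<gamma> = F (A z) (?d A) (B z) (?d B) (C z) (?d C) (D z) (?d D)" for A B C D
    by (simp add: schouten_dec_def lie_bracket_def F_def)
  have "schouten (\<lambda>x. wedge2 (A x) (B x)) (\<lambda>x. wedge2 (C x) (D x)) z \<alpha> \<beta> \<gamma> =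
     1/4 * (\<Sum>i\<in>Basis. \<Sum>j\<in>Basis. \<Sum>k\<in>Basis. \<Sum>l\<in>Basis.
       F (wedge2 (C z) (D z) (cob k) (cob l) *\<^sub>R k)
         (\<lambda>v. ?W' (C z) (?d C) (D z) (?d D) k l v *\<^sub>R k) l (\<lambda>v. 0)
         (wedge2 (A z) (B z) (cob i) (cob j) *\<^sub>R i)
         (\<lambda>v. ?W' (A z) (?d A) (B z) (?d B) i j v *\<^sub>R i) j (\<lambda>v. 0))"
    unfolding schouten_def F dW[OF diff(1,2)] dW[OF diff(3,4)] frechet_derivative_const
    by (subst swap) (rule refl)
  also have "\<dots> = 1/2 * (\<Sum>i\<in>Basis. \<Sum>j\<in>Basis.
       F (wedge2 (A z) (B z) (cob i) (cob j) *\<^sub>R i)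
         (\<lambda>v. ?W' (A z) (?d A) (B z) (?d B) i j v *\<^sub>R i) j (\<lambda>v. 0) (C z) (?d C) (D z) (?d D))"
    unfolding half[OF lW[OF diff(1,2)] l0]
    unfolding swap[of "C z"] by (simp add: sum_distrib_left)
  also have "\<dots> = schouten_dec A B C D z \<alpha> \<beta> \<gamma>"
    unfolding half[OF lin[OF diff(3)] lin[OF diff(4)]] F by simp
  finally show "schouten (\<lambda>x. wedge2 (A x) (B x)) (\<lambda>x. wedge2 (C x) (D x)) z \<alpha> \<beta> \<gamma> =
     schouten_dec A B C D z \<alpha> \<beta> \<gamma>" .
qed

end

(* Linear vector fields satisfy [X_V, Y_V] = -[X,Y]_V, so [r_V, r_V](z) is minus the image of the
   invariant trivector T = [r,r] under X |-> X z.  Scalar matrices commute with everything, so T is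
   even u(n)-invariant, and the rank-one elements i v v^* already suffice: those with v orthogonal
   to z, and v = z, force the image of T at a unit vector z to be a multiple kappa(z) of Jz /\ pi_0.
   For orthonormal z, v the number kappa(z) is the value of T on a basis of the copy of su(2) acting
   on the span of z and v; such a value does not change when (z,v) is rotated, so kappa is constant.

   By the formula for the multiplicative structure, r_V + Delta gives a Poisson action iff Delta is
   SU(n)-invariant.  Then [X_V /\ Y_V, Delta] = X_V /\ L_Y Delta - Y_V /\ L_X Delta = 0, because
   explicit one-parameter groups of 2x2 blocks show L_X Delta = 0 for X spanning su(n); hence
   [r_V + Delta, r_V + Delta] = [r_V, r_V] + [Delta, Delta]. *)
theory Submission
  imports Defs
begin

text \<open>At a unit vector z the phase generator at z excludes components transversal to the
  complex line of z; as z itself contributes nothing, one factor must be J z, and a skew form on the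
  complex orthogonal complement remains. Phases in the lines of that complement make it vanish on
  complex orthogonal pairs, so it is a multiple of <J b, c>, which is minus pi_0. The image of T is
  cubic in z and J z accounts for one degree, which leaves the square of the norm. The condition n
  >= 2 supplies the unit vector v that defines \<kappa>. The obstacle is that T is invariant only
  infinitesimally, and is a form on covectors of all matrices. Transitivity of SU(n) on the sphere
  is therefore not what compares \<kappa> at two points: the covectors X |-> <a, X z> are replaced
  by the family \<open>mcov\<close>, stable under the coadjoint action, in which the rotation of (z,
  v) is carried out by hand. No exponential map appears either: the generators of su(n) are
  normalised so that they square to minus a projection, and cosine and sine give the curve.\<close>

section \<open>Smooth bivector fields\<close>

lemma differentiable_onD_at: "f differentiable_on UNIV \<Longrightarrow> f differentiable at x"
  by (simp add: differentiable_on_def)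

text \<open>For the product rule: an undifferentiated factor of class \<open>Suc k\<close> has to be
  used there as one of class \<open>k\<close>.\<close>

lemma Ck_Suc_imp: "Ck (Suc k) f \<Longrightarrow> Ck k f"
proof (induction k arbitrary: f)
  case 0
  then show ?case by (simp add: differentiable_imp_continuous_on)
next
  case (Suc k)
  then show ?case by (metis Ck.simps(2))
qed

lemma Ck_const: "Ck k (\<lambda>_. c)"
  by (induction k arbitrary: c) (simp_all add: frechet_derivative_const)

lemma Ck_linear: "bounded_linear f \<Longrightarrow> Ck k f"
proof (cases k)
  case (Suc m)
  assume f: "bounded_linear f"
  then have "frechet_derivative f (at x) = f" for x
    by (metis bounded_linear_imp_has_derivative frechet_derivative_at)
  with f Suc show ?thesis
    by (auto simp: Ck_const intro: bounded_linear_imp_differentiable differentiable_at_imp_differentiable_on)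
qed (simp add: linear_continuous_on)

lemma frechet_derivative_add_fun:
  assumes "f differentiable at x" "g differentiable at x"
  shows "frechet_derivative (\<lambda>x. f x + g x) (at x) = (\<lambda>v. frechet_derivative f (at x) v + frechet_derivative g (at x) v)"
  by (rule frechet_derivative_at[symmetric]) (use assms in \<open>auto intro!: derivative_intros simp: frechet_derivative_works\<close>)

lemma Ck_add: "Ck k f \<Longrightarrow> Ck k g \<Longrightarrow> Ck k (\<lambda>x. f x + g x)"
proof (induction k arbitrary: f g)
  case 0
  then show ?case by (simp add: continuous_on_add)
next
  case (Suc k)
  then show ?case
    by (simp add: frechet_derivative_add_fun differentiable_onD_at)
qed

lemma Ck_mult: "Ck k f \<Longrightarrow> Ck k g \<Longrightarrow> Ck k (\<lambda>x. f x * g x)"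
proof (induction k arbitrary: f g)
  case 0
  then show ?case by (simp add: continuous_on_mult)
next
  case (Suc k)
  from Suc.prems have d: "f differentiable at x" "g differentiable at x" for x
    by (auto simp: differentiable_onD_at)
  have *: "frechet_derivative (\<lambda>x. f x * g x) (at x)
      = (\<lambda>v. f x * frechet_derivative g (at x) v + frechet_derivative f (at x) v * g x)" for x
    by (rule frechet_derivative_at[symmetric])
      (use d in \<open>auto intro!: derivative_intros simp: frechet_derivative_works\<close>)
  from Suc show ?case
    unfolding Ck.simps(2) * by (auto intro!: Ck_add Suc.IH Ck_Suc_imp[of k f] Ck_Suc_imp[of k g])
qed

lemma smooth_add: "smooth f \<Longrightarrow> smooth g \<Longrightarrow> smooth (\<lambda>x. f x + g x)"
  and smooth_mult: "smooth f \<Longrightarrow> smooth g \<Longrightarrow> smooth (\<lambda>x. f x * g x)"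
  and smooth_linear: "bounded_linear f \<Longrightarrow> smooth f"
  and smooth_const: "smooth (\<lambda>_. c)"
  by (simp_all add: smooth_def Ck_add Ck_mult Ck_linear Ck_const)

lemma smooth_diff: "smooth f \<Longrightarrow> smooth g \<Longrightarrow> smooth (\<lambda>x. f x - g x)"
  using smooth_add[of f "\<lambda>x. -1 * g x"] smooth_mult[of "\<lambda>_. -1" g] by (simp add: smooth_const)

lemma smooth_sum: "(\<And>i. i \<in> I \<Longrightarrow> smooth (f i)) \<Longrightarrow> smooth (\<lambda>x. \<Sum>i\<in>I. f i x)"
  by (induction I rule: infinite_finite_induct) (simp_all add: smooth_const smooth_add)

lemma smooth_differentiable: "smooth f \<Longrightarrow> f differentiable at x"
  using Ck.simps(2)[of 0 f] unfolding smooth_def differentiable_on_def by blast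

lemma bilinear_add_fun: "bilinear b \<Longrightarrow> bilinear c \<Longrightarrow> bilinear (\<lambda>x y. b x y + c x y)"
  by (simp add: bilinear_def linear_compose_add)

lemma bilinear_diff_fun: "bilinear b \<Longrightarrow> bilinear c \<Longrightarrow> bilinear (\<lambda>x y. b x y - c x y)"
  by (simp add: bilinear_def linear_compose_sub)

lemma bivector_add: "bivector b \<Longrightarrow> bivector c \<Longrightarrow> bivector (\<lambda>\<alpha> \<beta>. b \<alpha> \<beta> + c \<alpha> \<beta>)"
  by (simp add: bivector_def bilinear_add_fun)

lemma bivector_diff: "bivector b \<Longrightarrow> bivector c \<Longrightarrow> bivector (\<lambda>\<alpha> \<beta>. b \<alpha> \<beta> - c \<alpha> \<beta>)"
  by (simp add: bivector_def bilinear_diff_fun)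

lemma bivector_wedge2: "bivector (wedge2 u v)"
  by (auto simp: bivector_def bilinear_def wedge2_def blinfun.add_left blinfun.scaleR_left algebra_simps intro!: linearI)

lemma bivector_sum: "(\<And>i. i \<in> I \<Longrightarrow> bivector (b i)) \<Longrightarrow> bivector (\<lambda>\<alpha> \<beta>. \<Sum>i\<in>I. b i \<alpha> \<beta>)"
proof (induction I rule: infinite_finite_induct)
  case (insert x F)
  then show ?case by (simp add: bivector_add)
qed (auto simp: bivector_def bilinear_def intro: module_hom_zero)

lemma bivector_antisym: assumes "bivector b" shows "b \<beta> \<alpha> = - b \<alpha> \<beta>"
proof -
  have "b (\<alpha> + \<beta>) (\<alpha> + \<beta>) = 0" "b \<alpha> \<alpha> = 0" "b \<beta> \<beta> = 0" "bilinear b"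
    using assms by (auto simp: bivector_def)
  then show ?thesis by (simp add: bilinear_ladd bilinear_radd)
qed

lemma bivector_field_add:
  "bivector_field \<pi> \<Longrightarrow> bivector_field \<sigma> \<Longrightarrow> bivector_field (\<lambda>z \<alpha> \<beta>. \<pi> z \<alpha> \<beta> + \<sigma> z \<alpha> \<beta>)"
  by (simp add: bivector_field_def bivector_add smooth_add)

lemma bivector_field_diff:
  "bivector_field \<pi> \<Longrightarrow> bivector_field \<sigma> \<Longrightarrow> bivector_field (\<lambda>z \<alpha> \<beta>. \<pi> z \<alpha> \<beta> - \<sigma> z \<alpha> \<beta>)"
  by (simp add: bivector_field_def bivector_diff smooth_diff)

lemma bivector_field_sum:
  "(\<And>i. i \<in> I \<Longrightarrow> bivector_field (\<pi> i)) \<Longrightarrow> bivector_field (\<lambda>z \<alpha> \<beta>. \<Sum>i\<in>I. \<pi> i z \<alpha> \<beta>)"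
  by (simp add: bivector_field_def bivector_sum smooth_sum)

lemma bivector_field_wedge2_linear:
  assumes "linear A" "linear B"
  shows "bivector_field (\<lambda>z. wedge2 (A z) (B z))"
proof -
  have "smooth (\<lambda>z. blinfun_apply \<alpha> (L z))" if "linear L" for \<alpha> L
    using that by (intro smooth_linear blinfun.bounded_linear_right[THEN bounded_linear_compose])
      (simp add: linear_conv_bounded_linear)
  then show ?thesis
    using assms unfolding bivector_field_def
    by (intro conjI allI bivector_wedge2) (auto simp: wedge2_def intro!: smooth_diff smooth_mult)
qed

section \<open>The Schouten bracket of bivector fields\<close>

text \<open>The bracket at \<open>z\<close> sees only first derivatives at \<open>z\<close>, so this
  is all that its additivity requires.\<close>

definition differentiable_field :: "('a::euclidean_space \<Rightarrow> 'a bivec) \<Rightarrow> 'a \<Rightarrow> bool" where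
  "differentiable_field \<pi> z \<longleftrightarrow> (\<forall>\<alpha> \<beta>. (\<lambda>x. \<pi> x \<alpha> \<beta>) differentiable at z)"

lemma bivector_field_imp_differentiable_field: "bivector_field \<pi> \<Longrightarrow> differentiable_field \<pi> z"
  by (simp add: bivector_field_def differentiable_field_def smooth_differentiable)

lemma differentiable_field_sum:
  "finite I \<Longrightarrow> (\<And>i. i \<in> I \<Longrightarrow> differentiable_field (\<pi> i) z) \<Longrightarrow> differentiable_field (\<lambda>x \<alpha> \<beta>. \<Sum>i\<in>I. \<pi> i x \<alpha> \<beta>) z"
  by (simp add: differentiable_field_def)

lemma lie_bracket_antisym: "lie_bracket B A z = - lie_bracket A B z"
  by (simp add: lie_bracket_def)

lemma schouten_dec_sym: "schouten_dec C D A B z \<alpha> \<beta> \<gamma> = schouten_dec A B C D z \<alpha> \<beta> \<gamma>"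
  unfolding schouten_dec_def schouten_rhs_def wedge3_def wedge12_def wedge2_def
    lie_bracket_antisym[of C A] lie_bracket_antisym[of C B] lie_bracket_antisym[of D A]
    lie_bracket_antisym[of D B]
  by (simp add: blinfun.minus_right algebra_simps)

lemma sum_swap3:
  "(\<Sum>i\<in>A. \<Sum>j\<in>B. \<Sum>k\<in>C. f i j k) = (\<Sum>k\<in>C. \<Sum>i\<in>A. \<Sum>j\<in>B. f i j k)"
  by (subst (2) sum.swap, subst sum.swap) (rule refl)

text \<open>In degree two the graded antisymmetry of the bracket is symmetry. Additivity thus has to
  be proved in one argument only.\<close>

lemma schouten_sym: "schouten \<sigma> \<pi> z = schouten \<pi> \<sigma> z"
  unfolding schouten_def
  by (subst schouten_dec_sym, subst (2) sum_swap3, subst (2) sum_swap3) (rule refl)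

lemma lie_bracket_add_left:
  assumes "A differentiable at z" "A' differentiable at z" "C differentiable at z"
  shows "lie_bracket (\<lambda>x. A x + A' x) C z = lie_bracket A C z + lie_bracket A' C z"
  using assms
  by (simp add: lie_bracket_def frechet_derivative_add_fun linear_add linear_frechet_derivative)

lemma schouten_dec_add:
  assumes "A differentiable at z" "A' differentiable at z" "C differentiable at z" "D differentiable at z"
  shows "schouten_dec (\<lambda>x. A x + A' x) B C D z \<alpha> \<beta> \<gamma> =
    schouten_dec A B C D z \<alpha> \<beta> \<gamma> + schouten_dec A' B C D z \<alpha> \<beta> \<gamma>"
  unfolding schouten_dec_def lie_bracket_add_left[OF assms(1-3)] lie_bracket_add_left[OF assms(1,2,4)]
    schouten_rhs_def wedge3_def wedge12_def wedge2_def
  by (simp add: blinfun.add_right algebra_simps)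

lemma schouten_add_left:
  assumes "differentiable_field \<pi> z" "differentiable_field \<pi>' z" "differentiable_field \<sigma> z"
  shows "schouten (\<lambda>x \<alpha> \<beta>. \<pi> x \<alpha> \<beta> + \<pi>' x \<alpha> \<beta>) \<sigma> z \<alpha> \<beta> \<gamma> =
    schouten \<pi> \<sigma> z \<alpha> \<beta> \<gamma> + schouten \<pi>' \<sigma> z \<alpha> \<beta> \<gamma>"
proof -
  have d: "(\<lambda>x. \<rho> x (cob i) (cob j) *\<^sub>R k) differentiable at z" if "differentiable_field \<rho> z"
    for \<rho> :: "'a \<Rightarrow> 'a bivec" and i j k :: 'a
    using that by (auto simp: differentiable_field_def intro!: differentiable_scaleR)
  show ?thesis
    unfolding schouten_def scaleR_left.add
    by (simp add: schouten_dec_add d assms sum.distrib algebra_simps)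
qed

lemma schouten_zero_left:
  assumes "differentiable_field \<sigma> z"
  shows "schouten (\<lambda>x \<alpha> \<beta>. 0) \<sigma> z \<alpha> \<beta> \<gamma> = 0"
  using schouten_add_left[of "\<lambda>_ _ _. 0" z "\<lambda>_ _ _. 0" \<sigma> \<alpha> \<beta> \<gamma>] assms
  by (simp add: differentiable_field_def)

lemma schouten_sum_left:
  assumes "finite I" "\<And>i. i \<in> I \<Longrightarrow> differentiable_field (\<pi> i) z" "differentiable_field \<sigma> z"
  shows "schouten (\<lambda>x \<alpha> \<beta>. \<Sum>i\<in>I. \<pi> i x \<alpha> \<beta>) \<sigma> z \<alpha> \<beta> \<gamma> = (\<Sum>i\<in>I. schouten (\<pi> i) \<sigma> z \<alpha> \<beta> \<gamma>)"
  using assms(1,2)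
proof induction
  case (insert i F)
  then show ?case
    by (simp add: schouten_add_left[OF _ differentiable_field_sum] assms(3))
qed (simp add: schouten_zero_left assms(3))

lemma schouten_sum_right:
  assumes "finite I" "\<And>i. i \<in> I \<Longrightarrow> differentiable_field (\<pi> i) z" "differentiable_field \<sigma> z"
  shows "schouten \<sigma> (\<lambda>x \<alpha> \<beta>. \<Sum>i\<in>I. \<pi> i x \<alpha> \<beta>) z \<alpha> \<beta> \<gamma> = (\<Sum>i\<in>I. schouten \<sigma> (\<pi> i) z \<alpha> \<beta> \<gamma>)"
  unfolding schouten_sym[of \<sigma>] by (rule schouten_sum_left[OF assms])

lemma schouten_add_add:
  assumes "bivector_field \<pi>" "bivector_field \<sigma>"
  shows "schouten (\<lambda>x \<alpha> \<beta>. \<pi> x \<alpha> \<beta> + \<sigma> x \<alpha> \<beta>) (\<lambda>x \<alpha> \<beta>. \<pi> x \<alpha> \<beta> + \<sigma> x \<alpha> \<beta>) z \<alpha> \<beta> \<gamma> =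
    schouten \<pi> \<pi> z \<alpha> \<beta> \<gamma> + 2 * schouten \<pi> \<sigma> z \<alpha> \<beta> \<gamma> + schouten \<sigma> \<sigma> z \<alpha> \<beta> \<gamma>"
proof -
  note d = assms[THEN bivector_field_imp_differentiable_field]
  let ?s = "\<lambda>x \<alpha> \<beta>. \<pi> x \<alpha> \<beta> + \<sigma> x \<alpha> \<beta>"
  have "schouten ?s ?s z \<alpha> \<beta> \<gamma> = schouten ?s \<pi> z \<alpha> \<beta> \<gamma> + schouten ?s \<sigma> z \<alpha> \<beta> \<gamma>"
    using schouten_add_left[OF d(1,2) bivector_field_imp_differentiable_field[OF bivector_field_add[OF assms]]]
    by (simp only: schouten_sym[of \<pi> ?s] schouten_sym[of \<sigma> ?s])
  then show ?thesis
    using schouten_add_left[OF d(1,2) d(1)] schouten_add_left[OF d(1,2) d(2)]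
    by (simp add: schouten_sym[of \<sigma> \<pi>])
qed

lemma bilinear_cob_expand:
  fixes b :: "('a::euclidean_space) bivec"
  assumes "bilinear b"
  shows "b \<alpha> \<beta> = (\<Sum>k\<in>Basis. \<Sum>l\<in>Basis. b (cob k) (cob l) * (\<alpha> k * \<beta> l))"
proof -
  have cov: "\<alpha> = (\<Sum>k\<in>Basis. blinfun_apply \<alpha> k *\<^sub>R cob k)" for \<alpha> :: "'a dual"
  proof (rule blinfun_eqI)
    fix v
    have "blinfun_apply \<alpha> v = blinfun_apply \<alpha> (\<Sum>k\<in>Basis. (v \<bullet> k) *\<^sub>R k)"
      by (simp add: euclidean_representation)
    then show "blinfun_apply \<alpha> v = blinfun_apply (\<Sum>k\<in>Basis. blinfun_apply \<alpha> k *\<^sub>R cob k) v"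
      by (simp add: blinfun.sum_left blinfun.scaleR_left dual_sum blinfun.scaleR_right mult.commute inner_commute)
  qed
  have lb: "linear (\<lambda>a. b a c)" "linear (b c)" for c
    using assms by (auto simp: bilinear_def)
  have "b \<alpha> \<beta> = b (\<Sum>k\<in>Basis. blinfun_apply \<alpha> k *\<^sub>R cob k) (\<Sum>k\<in>Basis. blinfun_apply \<beta> k *\<^sub>R cob k)"
    by (simp flip: cov)
  also have "\<dots> = (\<Sum>k\<in>Basis. \<Sum>l\<in>Basis. b (cob k) (cob l) * (\<alpha> k * \<beta> l))"
    unfolding linear_sum[OF lb(1)] linear_sum[OF lb(2)] 
    by (subst sum.swap) (simp add: linear_scale[OF lb(1)] linear_scale[OF lb(2)] mult_ac)
  finally show ?thesis .
qed

text \<open>Turns a bivector field into a sum of decomposable ones, to which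
  \<open>schouten_wedge2\<close> applies. Each unordered pair of basis vectors occurs twice, hence
  the factor 1/2.\<close>

lemma bivector_cob_expand:
  assumes "bivector b"
  shows "b = (\<lambda>\<alpha> \<beta>. \<Sum>k\<in>Basis. \<Sum>l\<in>Basis. wedge2 ((b (cob k) (cob l) / 2) *\<^sub>R k) l \<alpha> \<beta>)"
proof (intro ext)
  fix \<alpha> \<beta>
  have bl: "bilinear b" and "b \<beta> \<alpha> = - b \<alpha> \<beta>"
    using assms bivector_antisym by (auto simp: bivector_def)
  then have "b \<alpha> \<beta> = (b \<alpha> \<beta> - b \<beta> \<alpha>) / 2" by simp
  also have "\<dots> = (\<Sum>k\<in>Basis. \<Sum>l\<in>Basis. wedge2 ((b (cob k) (cob l) / 2) *\<^sub>R k) l \<alpha> \<beta>)"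
    unfolding bilinear_cob_expand[OF bl, of \<alpha>] bilinear_cob_expand[OF bl, of \<beta>] wedge2_def
    by (simp add: sum_subtractf[symmetric] sum_divide_distrib blinfun.scaleR_right field_simps)
  finally show "b \<alpha> \<beta> = (\<Sum>k\<in>Basis. \<Sum>l\<in>Basis. wedge2 ((b (cob k) (cob l) / 2) *\<^sub>R k) l \<alpha> \<beta>)" .
qed

lemma lie_bracket_linear:
  fixes X Y :: "complex^'n^'n"
  shows "lie_bracket (\<lambda>z. X *v z) (\<lambda>z. Y *v z) z = - (commutator X Y *v z)"
proof -
  have "frechet_derivative (\<lambda>z. X *v z) (at z) = (\<lambda>z. X *v z)" for X :: "complex^'n^'n"
    by (rule frechet_derivative_at[symmetric], rule bounded_linear_imp_has_derivative)
      (simp add: linear_matrix_vector_right linear_conv_bounded_linear[symmetric])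
  then show ?thesis
    by (simp add: lie_bracket_def commutator_def matrix_vector_mul_assoc matrix_vector_mult_diff_rdistrib)
qed

lemma matrix_vector_differentiable: "(\<lambda>z. (X::complex^'n^'n) *v z) differentiable at z"
  by (rule bounded_linear_imp_differentiable)
    (simp add: linear_matrix_vector_right linear_conv_bounded_linear[symmetric])

section \<open>The bracket of the induced bivector field\<close>

lemma bivector_field_r_V: "r \<in> wedge2_su \<Longrightarrow> bivector_field (r_V r)"
  by (auto simp: wedge2_su_def r_V_sum_wedge2[abs_def]
      intro!: bivector_field_sum bivector_field_wedge2_linear linear_matrix_vector_right)

lemma alg_schouten_sum_left:
  "alg_schouten (\<lambda>\<alpha> \<beta>. \<Sum>p\<in>I. r p \<alpha> \<beta>) s \<alpha> \<beta> \<gamma> = (\<Sum>p\<in>I. alg_schouten (r p) s \<alpha> \<beta> \<gamma>)"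
  by (induction I rule: infinite_finite_induct)
    (simp_all add: alg_schouten_def sum.distrib algebra_simps)

lemma alg_schouten_sum_right:
  "alg_schouten s (\<lambda>\<alpha> \<beta>. \<Sum>p\<in>I. r p \<alpha> \<beta>) \<alpha> \<beta> \<gamma> = (\<Sum>p\<in>I. alg_schouten s (r p) \<alpha> \<beta> \<gamma>)"
  by (induction I rule: infinite_finite_induct)
    (simp_all add: alg_schouten_def sum.distrib algebra_simps)

text \<open>Every summand of \<open>schouten_rhs\<close> contains exactly one bracket, so the sign
  in \<open>lie_bracket_linear\<close> comes out once.\<close>

lemma schouten_wedge2_linear:
  fixes X Y U W :: "complex^'n^'n"
  shows "schouten (\<lambda>z. wedge2 (X *v z) (Y *v z)) (\<lambda>z. wedge2 (U *v z) (W *v z)) z \<alpha> \<beta> \<gamma> =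
    - alg_schouten (wedge2 X Y) (wedge2 U W) (pullcov (\<lambda>X. X *v z) \<alpha>) (pullcov (\<lambda>X. X *v z) \<beta>)
        (pullcov (\<lambda>X. X *v z) \<gamma>)"
  unfolding alg_schouten_wedge2 schouten_wedge2[OF matrix_vector_differentiable matrix_vector_differentiable
    matrix_vector_differentiable matrix_vector_differentiable] schouten_dec_def lie_bracket_linear
  unfolding schouten_rhs_def wedge3_def wedge12_def wedge2_def pullcov_apply[OF linear_matrix_vector_left]
  by (simp add: blinfun.minus_right algebra_simps)

lemma schouten_r_V:
  assumes "r \<in> wedge2_su"
  shows "schouten (r_V r) (r_V r) z \<alpha> \<beta> \<gamma> =
    - alg_schouten r r (pullcov (\<lambda>X. X *v z) \<alpha>) (pullcov (\<lambda>X. X *v z) \<beta>) (pullcov (\<lambda>X. X *v z) \<gamma>)"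
proof -
  obtain N :: nat and X Y where r: "r = (\<lambda>\<alpha> \<beta>. \<Sum>i<N. wedge2 (X i) (Y i) \<alpha> \<beta>)"
    using assms by (auto simp: wedge2_su_def)
  have d: "differentiable_field (\<lambda>z. wedge2 (X i *v z) (Y i *v z)) z" for i z
    by (intro bivector_field_imp_differentiable_field bivector_field_wedge2_linear linear_matrix_vector_right)
  have "schouten (r_V r) (r_V r) z \<alpha> \<beta> \<gamma> =
     (\<Sum>i<N. \<Sum>j<N. schouten (\<lambda>z. wedge2 (X i *v z) (Y i *v z)) (\<lambda>z. wedge2 (X j *v z) (Y j *v z)) z \<alpha> \<beta> \<gamma>)"
    unfolding r r_V_sum_wedge2[abs_def]
    by (simp add: schouten_sum_left schouten_sum_right d differentiable_field_sum)
  then show ?thesis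
    unfolding schouten_wedge2_linear r alg_schouten_sum_left alg_schouten_sum_right
    by (simp add: sum_negf)
qed

section \<open>The Lie algebra su(n) and its invariant trivectors\<close>

lemma cadjoint_nth: "cadjoint A $ i $ j = cnj (A $ j $ i)"
  by (simp add: cadjoint_def map_matrix_def transpose_def)

lemma trace_mult_commute: "trace (A ** B) = trace (B ** (A::complex^'n^'n))"
  by (simp add: trace_def matrix_matrix_mult_def) (subst sum.swap, simp add: mult.commute)

lemma trace_minus: "trace (A - B) = trace A - trace (B::complex^'n^'n)"
  by (simp add: trace_def sum_subtractf)

lemma commutator_su: "X \<in> su \<Longrightarrow> Y \<in> su \<Longrightarrow> commutator X Y \<in> su"
proof -
  assume a: "X \<in> su" "Y \<in> su"
  have e: "cnj (X $ j $ i) = - X $ i $ j" "cnj (Y $ j $ i) = - Y $ i $ j" for i j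
    using a by (auto simp: su_def vec_eq_iff cadjoint_nth)
  show ?thesis
    by (auto simp: su_def commutator_def vec_eq_iff cadjoint_nth matrix_matrix_mult_def e trace_minus
        trace_mult_commute[of X Y, unfolded matrix_matrix_mult_def]
        sum_subtractf[symmetric] sum_negf[symmetric] mult.commute simp del: sum_subtractf)
qed

text \<open>An invariant element of the third exterior power of su(n), as an alternating form on
  covectors of the space of all matrices. \<open>support1\<close> expresses that it comes from
  su(n): only restrictions of covectors to \<open>su\<close> matter, which later allows a covector
  to be exchanged for a handier one. The swaps carry linearity and support to the other
  slots.\<close>

locale su_trivector =
  fixes T :: "(complex^'n^'n) trivec"
  assumes add1: "T (\<alpha> + \<alpha>') \<beta> \<gamma> = T \<alpha> \<beta> \<gamma> + T \<alpha>' \<beta> \<gamma>"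
    and scale1: "T (c *\<^sub>R \<alpha>) \<beta> \<gamma> = c * T \<alpha> \<beta> \<gamma>"
    and swap12: "T \<beta> \<alpha> \<gamma> = - T \<alpha> \<beta> \<gamma>"
    and swap23: "T \<alpha> \<gamma> \<beta> = - T \<alpha> \<beta> \<gamma>"
    and support1: "(\<And>X. X \<in> su \<Longrightarrow> blinfun_apply \<alpha> X = blinfun_apply \<alpha>' X) \<Longrightarrow> T \<alpha> \<beta> \<gamma> = T \<alpha>' \<beta> \<gamma>"
    and su_inv: "su_invariant T"

lemma classical_r_matrix_su_trivector:
  assumes "classical_r_matrix r"
  shows "su_trivector (alg_schouten r r)"
proof -
  obtain N :: nat and X Y where su: "\<And>i. i < N \<Longrightarrow> X i \<in> su" "\<And>i. i < N \<Longrightarrow> Y i \<in> su"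
    and r: "r = (\<lambda>\<alpha> \<beta>. \<Sum>i<N. wedge2 (X i) (Y i) \<alpha> \<beta>)"
    using assms by (auto simp: classical_r_matrix_def wedge2_su_def)
  have T: "alg_schouten r r \<alpha> \<beta> \<gamma> = (\<Sum>i<N. \<Sum>j<N. schouten_rhs (commutator (X i) (X j))
     (commutator (X i) (Y j)) (commutator (Y i) (X j)) (commutator (Y i) (Y j)) (X i) (Y i) (X j) (Y j) \<alpha> \<beta> \<gamma>)"
    for \<alpha> \<beta> \<gamma>
    unfolding r alg_schouten_sum_left alg_schouten_sum_right alg_schouten_wedge2 ..
  note simps = schouten_rhs_def wedge3_def wedge12_def wedge2_def
  show ?thesis
  proof
    show "su_invariant (alg_schouten r r)"
      using assms by (simp add: classical_r_matrix_def)
    show "alg_schouten r r (\<alpha> + \<alpha>') \<beta> \<gamma> = alg_schouten r r \<alpha> \<beta> \<gamma> + alg_schouten r r \<alpha>' \<beta> \<gamma>" for \<alpha> \<alpha>' \<beta> \<gamma>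
      unfolding T simps sum.distrib[symmetric] by (simp add: blinfun.add_left algebra_simps)
    show "alg_schouten r r (c *\<^sub>R \<alpha>) \<beta> \<gamma> = c * alg_schouten r r \<alpha> \<beta> \<gamma>" for c \<alpha> \<beta> \<gamma>
      unfolding T simps sum_distrib_left by (simp add: blinfun.scaleR_left algebra_simps)
    show "alg_schouten r r \<beta> \<alpha> \<gamma> = - alg_schouten r r \<alpha> \<beta> \<gamma>" for \<alpha> \<beta> \<gamma>
      unfolding T simps sum_negf[symmetric] by (simp add: algebra_simps)
    show "alg_schouten r r \<alpha> \<gamma> \<beta> = - alg_schouten r r \<alpha> \<beta> \<gamma>" for \<alpha> \<beta> \<gamma>
      unfolding T simps sum_negf[symmetric] by (simp add: algebra_simps)
    show "alg_schouten r r \<alpha> \<beta> \<gamma> = alg_schouten r r \<alpha>' \<beta> \<gamma>"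
      if "\<And>X. X \<in> su \<Longrightarrow> blinfun_apply \<alpha> X = blinfun_apply \<alpha>' X" for \<alpha> \<alpha>' \<beta> \<gamma>
      \<comment> \<open>\<open>su\<close> is closed under commutators, so every vector at which
        \<alpha> is evaluated lies in \<open>su\<close>.\<close>
      unfolding T simps by (intro sum.cong refl) (simp add: that commutator_su su)
  qed
qed

section \<open>Covectors on matrices and invariance\<close>

context su_trivector
begin

lemma add2: "T \<beta> (\<alpha> + \<alpha>') \<gamma> = T \<beta> \<alpha> \<gamma> + T \<beta> \<alpha>' \<gamma>"
  by (simp add: swap12[of \<beta>] add1)

lemma add3: "T \<beta> \<gamma> (\<alpha> + \<alpha>') = T \<beta> \<gamma> \<alpha> + T \<beta> \<gamma> \<alpha>'"
  by (simp add: swap23[of _ \<gamma>] add2)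

lemma scale2: "T \<beta> (c *\<^sub>R \<alpha>) \<gamma> = c * T \<beta> \<alpha> \<gamma>"
  by (simp add: swap12[of \<beta>] scale1)

lemma scale3: "T \<beta> \<gamma> (c *\<^sub>R \<alpha>) = c * T \<beta> \<gamma> \<alpha>"
  by (simp add: swap23[of _ \<gamma>] scale2)

lemma minus1: "T (- \<alpha>) \<beta> \<gamma> = - T \<alpha> \<beta> \<gamma>"
  and minus2: "T \<beta> (- \<alpha>) \<gamma> = - T \<beta> \<alpha> \<gamma>"
  and minus3: "T \<beta> \<gamma> (- \<alpha>) = - T \<beta> \<gamma> \<alpha>"
  using scale1[of "-1" \<alpha>] scale2[of _ "-1" \<alpha>] scale3[of _ _ "-1" \<alpha>] by simp_all

lemma diff1: "T (\<alpha> - \<alpha>') \<beta> \<gamma> = T \<alpha> \<beta> \<gamma> - T \<alpha>' \<beta> \<gamma>"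
  and diff2: "T \<beta> (\<alpha> - \<alpha>') \<gamma> = T \<beta> \<alpha> \<gamma> - T \<beta> \<alpha>' \<gamma>"
  and diff3: "T \<beta> \<gamma> (\<alpha> - \<alpha>') = T \<beta> \<gamma> \<alpha> - T \<beta> \<gamma> \<alpha>'"
  using add1[of \<alpha> "- \<alpha>'"] add2[of _ \<alpha> "- \<alpha>'"] add3[of _ _ \<alpha> "- \<alpha>'"]
  by (simp_all add: minus1 minus2 minus3)

lemma zero1: "T 0 \<beta> \<gamma> = 0" and zero2: "T \<beta> 0 \<gamma> = 0" and zero3: "T \<beta> \<gamma> 0 = 0"
  using scale1[of 0] scale2[of _ 0] scale3[of _ _ 0] by simp_all

lemma alt12: "T \<alpha> \<alpha> \<gamma> = 0" and alt23: "T \<gamma> \<alpha> \<alpha> = 0" and alt13: "T \<alpha> \<gamma> \<alpha> = 0"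
  using swap12[of \<alpha> \<alpha>] swap23[of _ \<alpha> \<alpha>] swap12[of \<alpha> \<gamma> \<alpha>] swap23[of \<gamma> \<alpha> \<alpha>] by simp_all

lemmas lin = add1 add2 add3 scale1 scale2 scale3 minus1 minus2 minus3 diff1 diff2 diff3
  zero1 zero2 zero3 alt12 alt23 alt13

lemma support:
  assumes "\<And>X. X \<in> su \<Longrightarrow> blinfun_apply \<alpha> X = blinfun_apply \<alpha>' X"
    "\<And>X. X \<in> su \<Longrightarrow> blinfun_apply \<beta> X = blinfun_apply \<beta>' X"
    "\<And>X. X \<in> su \<Longrightarrow> blinfun_apply \<gamma> X = blinfun_apply \<gamma>' X"
  shows "T \<alpha> \<beta> \<gamma> = T \<alpha>' \<beta>' \<gamma>'"
proof -
  have "T \<alpha> \<beta> \<gamma> = T \<alpha>' \<beta> \<gamma>" by (rule support1[OF assms(1)])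
  also have "\<dots> = T \<alpha>' \<beta>' \<gamma>"
    unfolding swap12[of \<alpha>' \<beta>] swap12[of \<alpha>' \<beta>'] using support1[OF assms(2)] by simp
  also have "\<dots> = T \<alpha>' \<beta>' \<gamma>'"
    unfolding swap23[of _ \<beta>' \<gamma>] swap23[of _ \<beta>' \<gamma>'] swap12[of \<alpha>' \<gamma>] swap12[of \<alpha>' \<gamma>']
    using support1[OF assms(3)] by simp
  finally show ?thesis .
qed

lemma u_invariant:
  assumes X: "cadjoint X = - X"
  shows "T (pullcov (commutator X) \<alpha>) \<beta> \<gamma> + T \<alpha> (pullcov (commutator X) \<beta>) \<gamma>
     + T \<alpha> \<beta> (pullcov (commutator X) \<gamma>) = 0"
proof -
  \<comment> \<open>The mean of the diagonal of \<open>X\<close>. It is imaginary, so removing it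
    keeps the matrix skew-hermitian while making the trace vanish.\<close>
  define c where "c = trace X / of_nat CARD('n)"
  define Z where "Z = X - mat c"
  have x: "cnj (X $ j $ i) = - X $ i $ j" for i j
    using X by (auto simp: vec_eq_iff cadjoint_nth)
  have "cnj c = - c"
    by (simp add: c_def trace_def x sum_negf)
  then have "cadjoint Z = - Z"
    by (auto simp: Z_def vec_eq_iff cadjoint_nth x mat_def)
  moreover have "trace Z = 0"
    by (simp add: Z_def trace_minus) (simp add: trace_def mat_def c_def)
  ultimately have "Z \<in> su" by (simp add: su_def)
  moreover have "commutator Z = commutator X"
  proof
    fix Y :: "complex^'n^'n"
    have "mat c ** Y = Y ** mat c"
      by (simp add: vec_eq_iff matrix_matrix_mult_def mat_def if_distrib[of "\<lambda>x. x * _"]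
          if_distrib[of "\<lambda>x. _ * x"] mult.commute cong: if_cong)
    moreover have "(X - mat c) ** Y = X ** Y - mat c ** Y" "Y ** (X - mat c) = Y ** X - Y ** mat c"
      by (simp_all add: vec_eq_iff matrix_matrix_mult_def algebra_simps sum_subtractf)
    ultimately show "commutator Z Y = commutator X Y"
      by (simp add: commutator_def Z_def)
  qed
  ultimately show ?thesis
    using su_inv unfolding su_invariant_def by metis
qed

end

lemma linear_commutator: "linear (commutator (X::complex^'n^'n))"
  by (auto intro!: linearI simp: commutator_def matrix_matrix_mult_def vec_eq_iff algebra_simps
        sum.distrib scaleR_sum_right)

lemma skew_inner:
  assumes "cadjoint X = - X"
  shows "(X *v a) \<bullet> b = - (a \<bullet> (X *v b))"
proof -
  have x: "X $ i $ j = - cnj (X $ j $ i)" for i j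
    using assms by (auto simp: vec_eq_iff cadjoint_nth)
  have i: "a \<bullet> b = (\<Sum>i\<in>UNIV. Re (cnj (a $ i) * b $ i))" for a b :: "complex^'n"
    by (simp add: inner_vec_def inner_complex_def)
  have "(X *v a) \<bullet> b = (\<Sum>i\<in>UNIV. \<Sum>j\<in>UNIV. Re (cnj (X $ i $ j * a $ j) * b $ i))"
    unfolding i Re_sum[symmetric] by (simp add: matrix_vector_mult_def cnj_sum sum_distrib_right)
  also have "\<dots> = (\<Sum>j\<in>UNIV. \<Sum>i\<in>UNIV. Re (cnj (X $ i $ j * a $ j) * b $ i))"
    by (rule sum.swap)
  also have "\<dots> = (\<Sum>j\<in>UNIV. \<Sum>i\<in>UNIV. - Re (cnj (a $ j) * (X $ j $ i * b $ i)))"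
    by (intro sum.cong refl) (subst x, simp add: algebra_simps)
  also have "\<dots> = - (a \<bullet> (X *v b))"
    unfolding i matrix_vector_mult_def vec_lambda_beta sum_distrib_left Re_sum sum_negf ..
  finally show ?thesis .
qed

definition rank_one_skew :: "complex^'n \<Rightarrow> complex^'n^'n" where
  "rank_one_skew v = (\<chi> i j. \<i> * v $ i * cnj (v $ j))"

lemma cadjoint_rank_one_skew: "cadjoint (rank_one_skew v) = - rank_one_skew v"
  by (simp add: vec_eq_iff cadjoint_nth rank_one_skew_def)

lemma J_nth: "J v $ i = \<i> * v $ i"
  by (simp add: J_def)

lemma J_linear: "J (a + b) = J a + J b" "J (c *\<^sub>R a) = c *\<^sub>R J a" "J (- a) = - J a"
  "J (a - b) = J a - J b" "J 0 = 0" "J (J a) = - a"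
  by (simp_all add: vec_eq_iff J_nth algebra_simps)

lemma J_inner: "J a \<bullet> J b = a \<bullet> b" "a \<bullet> J b = - (J a \<bullet> b)" "J a \<bullet> a = 0"
  by (simp_all add: inner_vec_def inner_complex_def J_nth sum_negf[symmetric] algebra_simps)

lemma rank_one_skew_mult: "rank_one_skew v *v a = (a \<bullet> v) *\<^sub>R J v + (J a \<bullet> v) *\<^sub>R v"
proof -
  have h: "(\<Sum>k\<in>UNIV. cnj (v $ k) * a $ k) = Complex (a \<bullet> v) (- (J a \<bullet> v))"
    by (simp add: complex_eq_iff inner_vec_def inner_complex_def J_nth sum_negf[symmetric] algebra_simps)
  have "(rank_one_skew v *v a) $ i = \<i> * v $ i * (\<Sum>k\<in>UNIV. cnj (v $ k) * a $ k)" for i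
    by (simp add: rank_one_skew_def matrix_vector_mult_def sum_distrib_left mult.assoc)
  then show ?thesis
    unfolding h by (simp add: vec_eq_iff J_nth complex_eq_iff)
qed

text \<open>The covector \<open>X \<mapsto> \<langle>a, X z\<rangle>\<close>, antisymmetrised in \<open>a\<close> and \<open>z\<close>; on skew-hermitian \<open>X\<close> both agree.\<close>

definition mcov :: "complex^'n \<Rightarrow> complex^'n \<Rightarrow> (complex^'n^'n) dual" where
  "mcov a z = Blinfun (\<lambda>X. ((X *v z) \<bullet> a - (X *v a) \<bullet> z) / 2)"

lemma mcov_apply:
  fixes a z :: "complex^'n"
  shows "blinfun_apply (mcov a z) X = ((X *v z) \<bullet> a - (X *v a) \<bullet> z) / 2"
proof -
  have "linear (\<lambda>X::complex^'n^'n. ((X *v z) \<bullet> a - (X *v a) \<bullet> z) / 2)"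
    by (intro linearI) (simp_all add: linear_add[OF linear_matrix_vector_left]
        linear_scale[OF linear_matrix_vector_left] inner_add_left field_simps)
  then show ?thesis
    by (simp add: mcov_def bounded_linear_Blinfun_apply linear_conv_bounded_linear)
qed

lemma J_matrix_mult: "X *v J a = J (X *v a)"
  by (simp add: vec_eq_iff matrix_vector_mult_def J_nth sum_distrib_left algebra_simps)

lemma mcov_linear:
  "mcov (a + b) z = mcov a z + mcov b z" "mcov a (z + w) = mcov a z + mcov a w"
  "mcov (a - b) z = mcov a z - mcov b z" "mcov a (z - w) = mcov a z - mcov a w"
  "mcov (c *\<^sub>R a) z = c *\<^sub>R mcov a z" "mcov a (c *\<^sub>R z) = c *\<^sub>R mcov a z"
  "mcov (- a) z = - mcov a z" "mcov a (- z) = - mcov a z"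
  "mcov 0 z = 0" "mcov a 0 = 0"
  by (rule blinfun_eqI; simp add: mcov_apply blinfun.add_left blinfun.diff_left blinfun.minus_left
      blinfun.scaleR_left linear_add[OF linear_matrix_vector_right] linear_diff[OF linear_matrix_vector_right]
      linear_scale[OF linear_matrix_vector_right] linear_neg[OF linear_matrix_vector_right]
      linear_0[OF linear_matrix_vector_right] inner_add_left inner_add_right inner_diff_left inner_diff_right
      algebra_simps add_divide_distrib diff_divide_distrib)+

text \<open>This is what the antisymmetrisation buys: the relations hold as identities of covectors
  on all matrices, and no restriction to \<open>su\<close> has to be tracked in the calculations
  below.\<close>

lemma mcov_sym: "mcov z a = - mcov a z" and mcov_same: "mcov a a = 0"
  by (rule blinfun_eqI; simp add: mcov_apply blinfun.minus_left algebra_simps diff_divide_distrib)+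

lemma mcov_J: "mcov (J a) (J z) = mcov a z" "mcov a (J z) = - mcov (J a) z"
  by (rule blinfun_eqI, simp add: mcov_apply J_matrix_mult J_inner(1))
    (rule blinfun_eqI, simp add: mcov_apply J_matrix_mult J_inner(2) blinfun.minus_left field_simps)

text \<open>Skewness moves the outer \<open>X\<close> across the inner product. The coadjoint action
  thus stays inside the family \<open>mcov\<close>, acting as a derivation on the two vectors, and
  invariance of \<open>T\<close> becomes a statement about vectors.\<close>

lemma pullcov_commutator_mcov:
  assumes X: "cadjoint X = - X"
  shows "pullcov (commutator X) (mcov a z) = - (mcov (X *v a) z + mcov a (X *v z))"
proof (rule blinfun_eqI)
  fix Y
  have "blinfun_apply (pullcov (commutator X) (mcov a z)) Y = 
     ((X *v (Y *v z)) \<bullet> a - (Y *v (X *v z)) \<bullet> a - (X *v (Y *v a)) \<bullet> z + (Y *v (X *v a)) \<bullet> z) / 2"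
    by (simp add: pullcov_apply[OF linear_commutator] mcov_apply commutator_def
        matrix_vector_mul_assoc matrix_vector_mult_diff_rdistrib inner_diff_left)
  also have "\<dots> = blinfun_apply (- (mcov (X *v a) z + mcov a (X *v z))) Y"
    unfolding skew_inner[OF X]
    by (simp add: mcov_apply blinfun.minus_left blinfun.add_left blinfun.diff_left field_simps)
  finally show "blinfun_apply (pullcov (commutator X) (mcov a z)) Y = \<dots>" .
qed

text \<open>The action of \<open>rank_one_skew v\<close>, by \<open>rank_one_skew_mult\<close>: it
  multiplies the hermitian projection onto the line of \<open>v\<close> by i times the squared norm
  of \<open>v\<close>, and kills the complex orthogonal complement.\<close>

definition skew_act :: "complex^'n \<Rightarrow> complex^'n \<Rightarrow> complex^'n" where
  "skew_act v a = (a \<bullet> v) *\<^sub>R J v + (J a \<bullet> v) *\<^sub>R v"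

lemma (in su_trivector) mcov_invariant:
  "T (mcov (skew_act v a) z + mcov a (skew_act v z)) (mcov b w) (mcov c u) +
   T (mcov a z) (mcov (skew_act v b) w + mcov b (skew_act v w)) (mcov c u) +
   T (mcov a z) (mcov b w) (mcov (skew_act v c) u + mcov c (skew_act v u)) = 0"
  using u_invariant[OF cadjoint_rank_one_skew[of v], of "mcov a z" "mcov b w" "mcov c u"]
  unfolding pullcov_commutator_mcov[OF cadjoint_rank_one_skew] rank_one_skew_mult skew_act_def[symmetric] minus1 minus2 minus3
  by linarith

section \<open>Invariant trivectors of su(n)\<close>

definition cperp :: "complex^'n \<Rightarrow> complex^'n \<Rightarrow> bool" where
  "cperp z a \<longleftrightarrow> a \<bullet> z = 0 \<and> J a \<bullet> z = 0"

lemma cperp_sym: "cperp z a \<Longrightarrow> cperp a z"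
  using J_inner(2)[of a z] by (simp add: cperp_def inner_commute)

lemma cperp_J: "cperp z a \<Longrightarrow> cperp z (J a)"
  by (simp add: cperp_def J_linear)

lemma cperp_J_left: "cperp z a \<Longrightarrow> cperp (J z) a"
  by (meson cperp_J cperp_sym)

lemma cperp_add: "cperp z a \<Longrightarrow> cperp z b \<Longrightarrow> cperp z (a + b)"
  and cperp_diff: "cperp z a \<Longrightarrow> cperp z b \<Longrightarrow> cperp z (a - b)"
  and cperp_scale: "cperp z a \<Longrightarrow> cperp z (c *\<^sub>R a)"
  by (simp_all add: cperp_def J_linear inner_add_left inner_diff_left)

lemma skew_act_self: "skew_act z z = (z \<bullet> z) *\<^sub>R J z" "skew_act z (J z) = - (z \<bullet> z) *\<^sub>R z"
  by (simp_all add: skew_act_def J_inner J_linear)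

lemma skew_act_cperp: "cperp z a \<Longrightarrow> skew_act z a = 0"
  by (simp add: skew_act_def cperp_def)

lemma complex_line_decomp:
  assumes "v \<bullet> v = 1"
  obtains x y a' where "a = x *\<^sub>R v + y *\<^sub>R J v + a'" "cperp v a'" "x = a \<bullet> v" "y = - (J a \<bullet> v)"
proof
  show "a = (a \<bullet> v) *\<^sub>R v + (- (J a \<bullet> v)) *\<^sub>R J v + (a - (a \<bullet> v) *\<^sub>R v + (J a \<bullet> v) *\<^sub>R J v)"
    by simp
  show "cperp v (a - (a \<bullet> v) *\<^sub>R v + (J a \<bullet> v) *\<^sub>R J v)"
    using assms by (simp add: cperp_def J_linear J_inner inner_add_left inner_diff_left)
qed auto

section \<open>The trivector at a single unit vector\<close>

context su_trivector
begin

text \<open>The image of \<open>T\<close> under X |-> X z, evaluated at the covectors given by inner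
  products with \<open>a\<close>, \<open>b\<close>, \<open>c\<close>; \<open>mcov\<close> agrees on
  \<open>su\<close> with the pullbacks of these covectors.\<close>

definition tri :: "complex^'n \<Rightarrow> complex^'n \<Rightarrow> complex^'n \<Rightarrow> complex^'n \<Rightarrow> real" where
  "tri z a b c = T (mcov a z) (mcov b z) (mcov c z)"

lemma tri_linear:
  "tri z (a + a') b c = tri z a b c + tri z a' b c"
  "tri z a (b + b') c = tri z a b c + tri z a b' c"
  "tri z a b (c + c') = tri z a b c + tri z a b c'"
  "tri z (a - a') b c = tri z a b c - tri z a' b c"
  "tri z a (b - b') c = tri z a b c - tri z a b' c"
  "tri z a b (c - c') = tri z a b c - tri z a b c'"
  "tri z (x *\<^sub>R a) b c = x * tri z a b c"
  "tri z a (x *\<^sub>R b) c = x * tri z a b c"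
  "tri z a b (x *\<^sub>R c) = x * tri z a b c"
  "tri z (- a) b c = - tri z a b c"
  "tri z a (- b) c = - tri z a b c"
  "tri z a b (- c) = - tri z a b c"
  by (simp_all add: tri_def mcov_linear lin)

lemma tri_alt: "tri z a a b = 0" "tri z b a a = 0" "tri z a b a = 0"
  "tri z z a b = 0" "tri z a z b = 0" "tri z a b z = 0"
  by (simp_all add: tri_def mcov_same lin)

lemma tri_swap12: "tri z b a c = - tri z a b c" and tri_swap23: "tri z a c b = - tri z a b c"
  by (simp_all add: tri_def swap12[of "mcov b z"] swap23[of _ "mcov c z"])

text \<open>The phase generator at \<open>z\<close> kills \<open>a\<close>, \<open>b\<close>,
  \<open>c\<close> and turns \<open>z\<close> into \<open>J z\<close>; by \<open>mcov_J\<close> this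
  amounts to J acting as a derivation on the three slots. J has eigenvalues i and -i, so on triples
  the derivation has only the eigenvalues i, -i, 3i, -3i and is injective.\<close>

lemma tri_cperp_eq_0:
  assumes z: "z \<bullet> z = 1" and "cperp z a" "cperp z b" "cperp z c"
  shows "tri z a b c = 0"
proof -
  have D: "tri z (J a) b c + tri z a (J b) c + tri z a b (J c) = 0"
    if "cperp z a" "cperp z b" "cperp z c" for a b c
    using mcov_invariant[of z a z b z c z] that
    by (simp add: skew_act_self skew_act_cperp z mcov_linear mcov_J lin tri_def)
  note abc = assms(2-4)
  \<comment> \<open>Injectivity made explicit: with J put into one slot, \<open>D\<close> says that
    any two of the three terms containing two J's add up to \<open>tri z a b c\<close>; with J in
    all slots, it says that the three terms add up to 0.\<close>
  have "tri z (J a) (J b) c + tri z (J a) b (J c) = tri z a b c"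
    using D[OF cperp_J[OF abc(1)] abc(2,3)] by (simp add: J_linear tri_linear)
  moreover have "tri z (J a) (J b) c + tri z a (J b) (J c) = tri z a b c"
    using D[OF abc(1) cperp_J[OF abc(2)] abc(3)] by (simp add: J_linear tri_linear)
  moreover have "tri z (J a) b (J c) + tri z a (J b) (J c) = tri z a b c"
    using D[OF abc(1,2) cperp_J[OF abc(3)]] by (simp add: J_linear tri_linear)
  moreover have "tri z a (J b) (J c) + tri z (J a) b (J c) + tri z (J a) (J b) c = 0"
    using D[OF abc[THEN cperp_J]] by (simp add: J_linear tri_linear)
  ultimately show ?thesis by linarith
qed

text \<open>The phase generator at \<open>v\<close> fixes the other vectors and turns
  \<open>v\<close> into a multiple of \<open>J v\<close>, so only one term of the invariance
  identity survives. It contains \<open>J v\<close>; passing to \<open>- J v\<close> removes the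
  J.\<close>

lemma tri_orthogonal_eq_0:
  assumes "cperp z v" "cperp z b" "cperp v b"
  shows "tri z (J z) v b = 0"
proof -
  have *: "tri z (J z) (J v) b = 0" if "cperp z v" "cperp v b" for v
  proof (cases "v = 0")
    case False
    have "(v \<bullet> v) * tri z (J z) (J v) b = 0"
      using mcov_invariant[of v "J z" z v z b z] that cperp_sym[OF that(1)] cperp_J[OF cperp_sym[OF that(1)]]
      by (simp add: skew_act_self skew_act_cperp mcov_linear mcov_J mcov_same lin tri_def)
    with False show ?thesis by simp
  qed (simp add: J_linear tri_def mcov_linear lin)
  show ?thesis
    using *[of "- J v"] cperp_J[OF assms(1)] cperp_J_left[OF assms(3)]
    by (simp add: J_linear cperp_def)
qed

lemma tri_J_self:
  assumes z: "z \<bullet> z = 1" and v: "cperp z v" "v \<bullet> v = 1" and u: "cperp z u"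
  shows "tri z (J z) u (J u) = (u \<bullet> u) * tri z (J z) v (J v)"
proof -
  have orth: "tri z (J z) w (J w) = (w \<bullet> w) * tri z (J z) v (J v)" if w: "cperp z w" "cperp v w" for w
  proof -
    \<comment> \<open>Polarisation: \<open>v\<close> is rescaled to the length of \<open>w\<close>,
      which makes sum and difference complex orthogonal. Expanding the vanishing value at
      \<open>p\<close> and \<open>J q\<close> then compares the values at \<open>w\<close> and at
      \<open>v\<close>.\<close>
    define p where "p = norm w *\<^sub>R v + w"
    define q where "q = norm w *\<^sub>R v - w"
    have "w \<bullet> w = norm w * norm w"
      by (simp add: power2_norm_eq_inner[symmetric] power2_eq_square)
    then have "cperp p q"
      using w(2) cperp_sym[OF w(2)] v(2)
      by (auto simp: p_def q_def cperp_def J_linear J_inner inner_add_left inner_add_right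
          inner_diff_left inner_diff_right inner_commute[of w v])
    then have "tri z (J z) p (J q) = 0"
      by (intro tri_orthogonal_eq_0 cperp_J) (auto simp: p_def q_def cperp_add cperp_diff cperp_scale v w)
    moreover have "tri z (J z) v (J w) = 0" "tri z (J z) w (J v) = 0"
      by (intro tri_orthogonal_eq_0 cperp_J v w cperp_sym[OF w(2)])+
    ultimately show ?thesis
      using \<open>w \<bullet> w = norm w * norm w\<close> by (simp add: p_def q_def J_linear tri_linear)
  qed
  obtain x y w where u_eq: "u = x *\<^sub>R v + y *\<^sub>R J v + w" and w: "cperp v w"
    using complex_line_decomp[OF v(2), of u] by metis
  have "w = u - x *\<^sub>R v - y *\<^sub>R J v" using u_eq by simp
  then have zw: "cperp z w"
    by (simp add: cperp_diff cperp_scale cperp_J u v)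
  have 0: "tri z (J z) v w = 0" "tri z (J z) (J v) w = 0" "tri z (J z) v (J w) = 0"
    "tri z (J z) (J v) (J w) = 0" "tri z (J z) w v = 0" "tri z (J z) w (J v) = 0"
    using w zw v(1) by (auto intro!: tri_orthogonal_eq_0 cperp_J cperp_J_left intro: cperp_sym)
  have "u \<bullet> u = x * x + y * y + w \<bullet> w"
    using w cperp_sym[OF w] v(2) unfolding u_eq
    by (simp add: cperp_def J_inner J_linear inner_add_left inner_add_right inner_diff_left)
  moreover have "tri z (J z) u (J u) = (x * x + y * y) * tri z (J z) v (J v) + tri z (J z) w (J w)"
    unfolding u_eq by (simp add: J_linear tri_linear tri_alt 0 tri_swap23[of z "J z" "J v" v] algebra_simps)
  ultimately show ?thesis
    using orth[OF zw w] by (simp add: algebra_simps)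
qed

text \<open>In the decomposition of \<open>c\<close> along the complex line of \<open>b\<close>, the
  component along \<open>b\<close> drops out by alternation and the orthogonal one by
  \<open>tri_orthogonal_eq_0\<close>; only the coefficient of \<open>J b\<close> counts.\<close>

lemma tri_cperp:
  assumes z: "z \<bullet> z = 1" and v: "cperp z v" "v \<bullet> v = 1" and bc: "cperp z b" "cperp z c"
  shows "tri z (J z) b c = tri z (J z) v (J v) * (J b \<bullet> c)"
proof (cases "b = 0")
  case False
  define u where "u = (1 / norm b) *\<^sub>R b"
  have b: "b = norm b *\<^sub>R u" and u: "u \<bullet> u = 1"
    using False by (simp_all add: u_def power2_norm_eq_inner[symmetric] power2_eq_square)
  have zu: "cperp z u" using bc by (simp add: u_def cperp_scale)
  obtain x y w where c: "c = x *\<^sub>R u + y *\<^sub>R J u + w" and w: "cperp u w"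
    using complex_line_decomp[OF u, of c] by metis
  have "w = c - x *\<^sub>R u - y *\<^sub>R J u" using c by simp
  then have zw: "cperp z w"
    by (simp add: cperp_diff cperp_scale cperp_J bc zu)
  have "tri z (J z) u c = y * tri z (J z) v (J v)"
    unfolding c using tri_orthogonal_eq_0[OF zu zw w] tri_J_self[OF z v zu] u
    by (simp add: tri_linear tri_alt)
  moreover have "J u \<bullet> c = y"
    unfolding c using u cperp_sym[OF w]  by (simp add: cperp_def J_inner J_linear inner_add_right)
  ultimately show ?thesis
    by (subst (1 2) b) (simp add: tri_linear J_linear)
qed (simp add: tri_def mcov_linear lin J_linear)

text \<open>Components along \<open>z\<close> vanish because \<open>mcov z z\<close> is 0, two
  components along \<open>J z\<close> cancel by alternation, and three orthogonal ones give 0 by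
  \<open>tri_cperp_eq_0\<close>. So exactly one slot carries \<open>J z\<close>.\<close>

lemma tri_unit:
  assumes z: "z \<bullet> z = 1" and v: "cperp z v" "v \<bullet> v = 1"
  shows "tri z a b c = tri z (J z) v (J v) *
    ((J z \<bullet> a) * (J b \<bullet> c) - (J z \<bullet> b) * (J a \<bullet> c) + (J z \<bullet> c) * (J a \<bullet> b))"
proof -
  obtain xa ya a' where a: "a = xa *\<^sub>R z + ya *\<^sub>R J z + a'" and a': "cperp z a'"
    using complex_line_decomp[OF z, of a] by metis
  obtain xb yb b' where b: "b = xb *\<^sub>R z + yb *\<^sub>R J z + b'" and b': "cperp z b'"
    using complex_line_decomp[OF z, of b] by metis
  obtain xc yc c' where c: "c = xc *\<^sub>R z + yc *\<^sub>R J z + c'" and c': "cperp z c'"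
    using complex_line_decomp[OF z, of c] by metis
  have "tri z a b c = ya * tri z (J z) b' c' - yb * tri z (J z) a' c' + yc * tri z (J z) a' b'"
    unfolding a b c using tri_cperp_eq_0[OF z a' b' c']
    by (simp add: tri_linear tri_alt tri_swap12[of z _ "J z"] tri_swap23[of z _ _ "J z"])
  also have "\<dots> = tri z (J z) v (J v) * (ya * (J b' \<bullet> c') - yb * (J a' \<bullet> c') + yc * (J a' \<bullet> b'))"
    by (simp add: tri_cperp[OF z v] a' b' c' algebra_simps)
  also have "ya * (J b' \<bullet> c') - yb * (J a' \<bullet> c') + yc * (J a' \<bullet> b') =
     (J z \<bullet> a) * (J b \<bullet> c) - (J z \<bullet> b) * (J a \<bullet> c) + (J z \<bullet> c) * (J a \<bullet> b)"
  proof -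
    have y: "J z \<bullet> a = ya" "J z \<bullet> b = yb" "J z \<bullet> c = yc"
      unfolding a b c using z a' b' c' cperp_sym[OF a'] cperp_sym[OF b'] cperp_sym[OF c']
      by (simp_all add: cperp_def J_inner J_linear inner_add_right)
    have j: "J (x *\<^sub>R z + y *\<^sub>R J z + p) \<bullet> (x' *\<^sub>R z + y' *\<^sub>R J z + q) = x * y' - y * x' + J p \<bullet> q"
      if "cperp z p" "cperp z q" for x y x' y' p q
      using that that[THEN cperp_sym] z
      by (simp add: cperp_def J_inner J_linear inner_add_left inner_add_right inner_diff_left)
    show ?thesis
      unfolding y unfolding a b c j[OF b' c'] j[OF a' c'] j[OF a' b'] by (simp add: algebra_simps)
  qed
  finally show ?thesis .
qed

section \<open>Comparison of different unit vectors\<close>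

lemma swap13: "T \<gamma> \<beta> \<alpha> = - T \<alpha> \<beta> \<gamma>"
  using swap12[of \<gamma> \<beta> \<alpha>] swap23[of \<beta> \<gamma> \<alpha>] swap12[of \<beta> \<alpha> \<gamma>] by linarith

text \<open>The covector \<open>D + D'\<close> is the trace part on the span of \<open>z\<close> and
  \<open>v\<close>; it may be treated as zero here, by \<open>ED\<close> and \<open>EF\<close>. Then
  \<open>E\<close> is fixed while \<open>D\<close> and \<open>F\<close> turn by twice the angle, and
  the determinant of that rotation is 1.\<close>

lemma tri_rotate:
  assumes zv: "z \<bullet> z = 1" "v \<bullet> v = 1" "cperp z v" and cs: "c * c + s * s = 1"
  defines "w \<equiv> c *\<^sub>R z + s *\<^sub>R v" and "u \<equiv> c *\<^sub>R v - s *\<^sub>R z"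
  shows "tri w (J w) u (J u) = tri z (J z) v (J v)"
proof -
  define D where "D = mcov (J z) z"
  define D' where "D' = mcov (J v) v"
  define E where "E = mcov v z"
  define F where "F = mcov (J v) z"
  note z = skew_act_cperp[OF zv(3)] skew_act_cperp[OF cperp_J[OF zv(3)]]
  note defs = D_def D'_def E_def F_def
  have zv': "v \<bullet> z = 0" "z \<bullet> v = 0" "J v \<bullet> z = 0" "J z \<bullet> v = 0"
    using zv(3) cperp_sym[OF zv(3)] by (auto simp: cperp_def)
  \<comment> \<open>The generator at \<open>z\<close> fixes \<open>D\<close> and \<open>D'\<close>
    and takes \<open>F\<close> to \<open>E\<close>; the second instance applies it to
    (\<open>D'\<close>, \<open>F\<close>, \<open>D\<close>).\<close>
  have ED: "T (D + D') E D = 0"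
    using mcov_invariant[of z "J z" z "J v" z "J z" z] mcov_invariant[of z "J v" v "J v" z "J z" z]
    by (simp add: z skew_act_self zv J_linear mcov_linear mcov_J mcov_same lin defs)
  \<comment> \<open>The generator at \<open>z + v\<close> kills \<open>F\<close> and takes
    \<open>D\<close> and \<open>D'\<close> to opposite multiples of \<open>E\<close>, which relates
    \<open>T D E F\<close> to \<open>T D' E F\<close>.\<close>
  have EF: "T (D + D') E F = 0"
  proof -
    have K: "skew_act (z + v) z = J z + J v" "skew_act (z + v) v = J z + J v"
      "skew_act (z + v) (J z) = - z - v" "skew_act (z + v) (J v) = - z - v"
      by (simp_all add: skew_act_def J_linear J_inner zv zv' inner_add_right)
    have s: "mcov z v = - E" "mcov v z = E" "mcov (J z) v = F" "mcov (J v) z = F"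
      by (simp_all add: E_def F_def mcov_sym[of z v] mcov_sym[of "J z" v] mcov_J)
    show ?thesis
      using mcov_invariant[of "z + v" "J z" z "J z" z "J v" z]
        mcov_invariant[of "z + v" "J v" v "J z" z "J v" z]
        swap12[of E D F]
      by (simp add: K J_linear mcov_linear mcov_J mcov_same lin s flip: D_def D'_def)
  qed
  have "mcov (J w) w = (c * c) *\<^sub>R D + (s * s) *\<^sub>R D' + (2 * (c * s)) *\<^sub>R F"
    by (simp add: w_def J_linear mcov_linear defs mcov_sym[of "J z" v] mcov_J algebra_simps
        flip: scaleR_2)
  moreover have "mcov u w = E"
  proof -
    have "mcov u w = (c * c + s * s) *\<^sub>R E"
      by (simp add: u_def w_def mcov_linear mcov_same E_def mcov_sym[of z v] algebra_simps)
    then show ?thesis by (simp add: cs)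
  qed
  moreover have "mcov (J u) w = (c * c - s * s) *\<^sub>R F - (c * s) *\<^sub>R (D - D')"
    by (simp add: u_def w_def J_linear mcov_linear defs mcov_sym[of "J z" v] mcov_J algebra_simps)
  moreover have sw: "T F E D = - T D E F" "T F E D' = - T D' E F" "T D E D' = - T D' E D"
    by (rule swap13)+
  ultimately have "tri w (J w) u (J u) = ((c * c - s * s)\<^sup>2 + 4 * (c * s)\<^sup>2) * T D E F"
    using ED EF by (simp add: tri_def lin sw add_eq_0_iff2) (simp add: power2_eq_square algebra_simps)
  also have "(c * c - s * s)\<^sup>2 + 4 * (c * s)\<^sup>2 = (c * c + s * s)\<^sup>2"
    by algebra
  finally show ?thesis
    by (simp add: cs tri_def defs)
qed

text \<open>A phase leaves \<open>mcov (J z) z\<close> unchanged and rotates \<open>mcov v z\<close>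
  and \<open>mcov (J v) z\<close> into each other, with determinant 1.\<close>

lemma tri_phase:
  fixes z :: "complex^'n"
  assumes "x * x + y * y = 1"
  defines "w \<equiv> x *\<^sub>R z + y *\<^sub>R J z"
  shows "tri w (J w) v (J v) = tri z (J z) v (J v)"
proof -
  have "tri w (J w) v (J v) = (x * x + y * y) * (x * x + y * y) * tri z (J z) v (J v)"
    by (simp add: tri_def w_def J_linear mcov_linear mcov_J mcov_same mcov_sym[of z "J z"] lin
        swap23[of _ "mcov v z" "mcov (J v) z"] algebra_simps)
  then show ?thesis by (simp add: assms)
qed

lemma tri_constant:
  assumes z: "z \<bullet> z = 1" "v \<bullet> v = 1" "cperp z v" and w: "w \<bullet> w = 1"
  obtains u where "u \<bullet> u = 1" "cperp w u" "tri w (J w) u (J u) = tri z (J z) v (J v)"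
proof -
  obtain x y w' where w_eq: "w = x *\<^sub>R z + y *\<^sub>R J z + w'" and w': "cperp z w'"
    using complex_line_decomp[OF z(1), of w] by metis
  define r where "r = sqrt (x * x + y * y)"
  define s where "s = norm w'"
  have r: "r * r = x * x + y * y" and s: "s * s = w' \<bullet> w'"
    by (simp_all add: r_def s_def power2_norm_eq_inner[symmetric] power2_eq_square)
  have rs: "r * r + s * s = 1"
    using w z(1) w' cperp_sym[OF w'] unfolding r s w_eq
    by (simp add: cperp_def J_inner J_linear inner_add_left inner_add_right inner_diff_left)
  \<comment> \<open>\<open>w\<close> is reached from \<open>z\<close> by a phase, which gives
    \<open>z1\<close>, followed by a rotation towards \<open>v1\<close>. If a component of
    \<open>w\<close> vanishes, its direction is arbitrary and \<open>z\<close> or \<open>v\<close>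
    serves as default.\<close>
  define z1 where "z1 = (if r = 0 then z else (x / r) *\<^sub>R z + (y / r) *\<^sub>R J z)"
  define v1 where "v1 = (if s = 0 then v else (1 / s) *\<^sub>R w')"
  have xy: "(x / r) * (x / r) + (y / r) * (y / r) = 1" if "r \<noteq> 0"
    using that by (simp add: add_divide_distrib[symmetric] flip: r)
  have "w' = s *\<^sub>R v1" by (auto simp: v1_def s_def)
  moreover have "x *\<^sub>R z + y *\<^sub>R J z = r *\<^sub>R z1"
    using r by (auto simp: z1_def scaleR_add_right)
  ultimately have w_rot: "w = r *\<^sub>R z1 + s *\<^sub>R v1"
    by (simp add: w_eq)
  have v1: "cperp z v1" "v1 \<bullet> v1 = 1"
    using w' s z(2,3) by (auto simp: v1_def cperp_scale)
  have z1: "z1 \<bullet> z1 = 1"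
    using xy z(1) by (auto simp: z1_def inner_add_left inner_add_right J_inner J_linear inner_diff_left)
  have "cperp v1 z1"
    using cperp_sym[OF v1(1)] by (auto simp: z1_def intro!: cperp_add cperp_scale cperp_J)
  then have zv1: "cperp z1 v1" by (rule cperp_sym)
  define u where "u = r *\<^sub>R v1 - s *\<^sub>R z1"
  have "tri w (J w) u (J u) = tri z1 (J z1) v1 (J v1)"
    unfolding w_rot u_def using z1 v1(2) zv1 rs by (rule tri_rotate)
  also have "\<dots> = tri z (J z) v1 (J v1)"
    unfolding z1_def using tri_phase[OF xy] by simp
  also have "\<dots> = tri z (J z) v (J v)"
    using tri_J_self[OF z(1) z(3,2) v1(1)] v1(2) by simp
  finally have eq: "tri w (J w) u (J u) = tri z (J z) v (J v)" .
  have "u \<bullet> u = 1"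
    using zv1 cperp_sym[OF zv1] rs z1 v1
    by (simp add: u_def cperp_def inner_diff_left inner_diff_right algebra_simps)
  moreover have "cperp w u"
    unfolding w_rot u_def using zv1 cperp_sym[OF zv1] rs z1 v1
    by (simp add: cperp_def J_linear J_inner inner_diff_left inner_diff_right inner_add_left inner_add_right)
  ultimately show thesis using eq that by blast
qed

lemma tri_formula:
  assumes "CARD('n) \<ge> 2"
  obtains \<kappa> where "\<And>z a b c. tri z a b c = \<kappa> * (norm z)\<^sup>2 *
    ((J z \<bullet> a) * (J b \<bullet> c) - (J z \<bullet> b) * (J a \<bullet> c) + (J z \<bullet> c) * (J a \<bullet> b))"
proof -
  define e :: "complex^'n" where "e = axis undefined 1"
  have e: "e \<bullet> e = 1" by (simp add: e_def inner_axis_axis)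
  have "dim {e, J e} \<le> card {e, J e}" by (rule dim_le_card') simp
  \<comment> \<open>The complex line of \<open>e\<close> has real dimension at most 2, the whole
    space has dimension 2n, at least 4, so a vector orthogonal to the line exists.\<close>
  also have "\<dots> \<le> 2" by (simp add: card_insert_if)
  also have "\<dots> < DIM(complex^'n)" using assms by simp
  finally obtain v0 where v0: "v0 \<noteq> 0" "\<And>y. y \<in> span {e, J e} \<Longrightarrow> orthogonal v0 y"
    by (rule orthogonal_to_subspace_exists) blast
  define v where "v = (1 / norm v0) *\<^sub>R v0"
  have v: "v \<bullet> v = 1" using v0(1) by (simp add: v_def power2_norm_eq_inner[symmetric] power2_eq_square)
  have "v0 \<bullet> e = 0" "v0 \<bullet> J e = 0"
    using v0(2)[of e] v0(2)[of "J e"] by (auto simp: orthogonal_def span_base)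
  then have "cperp e v0" by (simp add: cperp_def J_inner)
  then have ev: "cperp e v" by (simp add: v_def cperp_scale)
  define \<kappa> where "\<kappa> = tri e (J e) v (J v)"
  show thesis
  proof
    fix z a b c
    show "tri z a b c = \<kappa> * (norm z)\<^sup>2 *
      ((J z \<bullet> a) * (J b \<bullet> c) - (J z \<bullet> b) * (J a \<bullet> c) + (J z \<bullet> c) * (J a \<bullet> b))"
    proof (cases "z = 0")
      case False
      define w where "w = (1 / norm z) *\<^sub>R z"
      have z: "z = norm z *\<^sub>R w" and w: "w \<bullet> w = 1"
        using False by (simp_all add: w_def power2_norm_eq_inner[symmetric] power2_eq_square)
      obtain u where u: "u \<bullet> u = 1" "cperp w u" "tri w (J w) u (J u) = \<kappa>"
        unfolding \<kappa>_def by (rule tri_constant[OF e v ev w])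
      have *: "tri w a b c = \<kappa> *
        ((J w \<bullet> a) * (J b \<bullet> c) - (J w \<bullet> b) * (J a \<bullet> c) + (J w \<bullet> c) * (J a \<bullet> b))"
        using tri_unit[OF w u(2,1), of a b c] unfolding u(3) .
      \<comment> \<open>Cubic homogeneity: one of the three factors \<open>norm z\<close> is
        absorbed in \<open>J z\<close>, and two remain.\<close>
      have "tri (t *\<^sub>R w) a b c = t * t * t * tri w a b c" for t
        by (simp add: tri_def mcov_linear lin)
      from this[of "norm z"] have "tri z a b c = norm z * norm z * norm z * tri w a b c"
        unfolding z[symmetric] .
      moreover have "J z = norm z *\<^sub>R J w" unfolding J_linear(2)[symmetric] z[symmetric] ..
      ultimately show ?thesis
        by (simp add: * power2_eq_square algebra_simps)
    qed (simp add: tri_def mcov_linear lin J_linear)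
  qed
qed

end

section \<open>Lie derivatives along linear vector fields\<close>

lemma dual_eq_inner:
  fixes \<alpha> :: "'a::euclidean_space dual"
  obtains a where "\<And>x. blinfun_apply \<alpha> x = x \<bullet> a"
proof
  fix x
  have "blinfun_apply \<alpha> x = blinfun_apply \<alpha> (\<Sum>k\<in>Basis. (x \<bullet> k) *\<^sub>R k)"
    by (simp add: euclidean_representation)
  also have "\<dots> = x \<bullet> (\<Sum>k\<in>Basis. blinfun_apply \<alpha> k *\<^sub>R k)"
    by (simp add: dual_sum blinfun.scaleR_right inner_sum_right mult.commute)
  finally show "blinfun_apply \<alpha> x = x \<bullet> (\<Sum>k\<in>Basis. blinfun_apply \<alpha> k *\<^sub>R k)" .
qed

lemma pi0_inner:
  assumes "\<And>x. blinfun_apply \<beta> x = x \<bullet> b" "\<And>x. blinfun_apply \<gamma> x = x \<bullet> c"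
  shows "pi0 \<beta> \<gamma> = - (J b \<bullet> c)"
  unfolding pi0_real wedge2_def assms
  by (simp add: inner_axis' inner_vec_def[of "J b"] inner_complex_def J_nth algebra_simps)

lemma schouten_r_V_eq:
  fixes r :: "(complex^'n^'n) bivec"
  assumes "CARD('n) \<ge> 2" and r: "classical_r_matrix r"
  obtains c where "\<And>z. schouten (r_V r) (r_V r) z
    = (\<lambda>\<alpha> \<beta> \<gamma>. - c * (norm z)\<^sup>2 * wedge12 (J z) pi0 \<alpha> \<beta> \<gamma>)"
proof -
  interpret su_trivector "alg_schouten r r"
    by (rule classical_r_matrix_su_trivector[OF r])
  obtain \<kappa> where \<kappa>: "\<And>z a b c. tri z a b c = \<kappa> * (norm z)\<^sup>2 *
    ((J z \<bullet> a) * (J b \<bullet> c) - (J z \<bullet> b) * (J a \<bullet> c) + (J z \<bullet> c) * (J a \<bullet> b))"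
    using tri_formula[OF assms(1)] by blast
  have su: "r \<in> wedge2_su"
    using r by (simp add: classical_r_matrix_def)
  show thesis
  \<comment> \<open>The bracket of \<open>r_V r\<close> is minus \<open>tri\<close>, and
    \<open>pi0_inner\<close> contributes a second sign; against the sign in front of c this gives
    \<open>- \<kappa>\<close>.\<close>
  proof (rule that[of "- \<kappa>"], intro ext)
    fix z :: "complex^'n" and \<alpha> \<beta> \<gamma> :: "(complex^'n) dual"
    obtain a where a: "\<And>x. blinfun_apply \<alpha> x = x \<bullet> a" using dual_eq_inner[of \<alpha>] by blast
    obtain b where b: "\<And>x. blinfun_apply \<beta> x = x \<bullet> b" using dual_eq_inner[of \<beta>] by blast
    obtain c where c: "\<And>x. blinfun_apply \<gamma> x = x \<bullet> c" using dual_eq_inner[of \<gamma>] by blast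
    note abc = a b c
    have *: "blinfun_apply (pullcov (\<lambda>X. X *v z) \<delta>) X = blinfun_apply (mcov d z) X"
      if "X \<in> su" "\<And>x. blinfun_apply \<delta> x = x \<bullet> d" for X \<delta> d
      using that skew_inner[of X d z]
      by (simp add: su_def pullcov_apply[OF linear_matrix_vector_left] mcov_apply inner_commute)
    have "schouten (r_V r) (r_V r) z \<alpha> \<beta> \<gamma> = - tri z a b c"
      unfolding schouten_r_V[OF su] tri_def neg_equal_iff_equal
      by (rule support; rule *; (assumption | rule abc))
    then show "schouten (r_V r) (r_V r) z \<alpha> \<beta> \<gamma> = - (- \<kappa>) * (norm z)\<^sup>2 * wedge12 (J z) pi0 \<alpha> \<beta> \<gamma>"
      unfolding \<kappa> wedge12_def abc pi0_inner[OF abc(2,3)] pi0_inner[OF abc(1,3)] pi0_inner[OF abc(1,2)]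
      by (simp add: algebra_simps)
  qed
qed

text \<open>The Lie derivative of \<Delta> along the field z |-> X z, evaluated at constant
  covectors; the Lie derivative of such a covector is its composition with \<open>X\<close>.\<close>

definition lie_deriv :: "complex^'n^'n \<Rightarrow> (complex^'n \<Rightarrow> (complex^'n) bivec) \<Rightarrow> complex^'n \<Rightarrow> (complex^'n) bivec" where
  "lie_deriv X \<Delta> z = (\<lambda>\<alpha> \<beta>. frechet_derivative (\<lambda>z. \<Delta> z \<alpha> \<beta>) (at z) (X *v z)
     - \<Delta> z (pullcov (\<lambda>v. X *v v) \<alpha>) \<beta> - \<Delta> z \<alpha> (pullcov (\<lambda>v. X *v v) \<beta>))"

lemma wedge12_sum: "wedge12 u (\<lambda>\<alpha> \<beta>. \<Sum>i\<in>I. b i \<alpha> \<beta>) \<alpha> \<beta> \<gamma> = (\<Sum>i\<in>I. wedge12 u (b i) \<alpha> \<beta> \<gamma>)"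
  by (simp add: wedge12_def sum_distrib_left sum_subtractf sum.distrib)

lemma schouten_linear_wedge2_field:
  fixes X Y :: "complex^'n^'n"
  assumes \<Delta>: "bivector_field \<Delta>"
  shows "schouten (\<lambda>z. wedge2 (X *v z) (Y *v z)) \<Delta> z \<alpha> \<beta> \<gamma> =
    wedge12 (X *v z) (lie_deriv Y \<Delta> z) \<alpha> \<beta> \<gamma> - wedge12 (Y *v z) (lie_deriv X \<Delta> z) \<alpha> \<beta> \<gamma>"
proof -
  define f where "f k l z = \<Delta> z (cob k) (cob l) / 2" for k l z
  have bv: "bivector (\<Delta> z)" for z
    using \<Delta> by (simp add: bivector_field_def)
  have \<Delta>_eq: "\<Delta> z = (\<lambda>\<alpha> \<beta>. \<Sum>k\<in>Basis. \<Sum>l\<in>Basis. wedge2 (f k l z *\<^sub>R k) l \<alpha> \<beta>)" for z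
    unfolding f_def by (rule bivector_cob_expand[OF bv])
  have df: "f k l differentiable at z" for k l z
    using bivector_field_imp_differentiable_field[OF \<Delta>] unfolding f_def
    by (auto simp: differentiable_field_def)
  have dfk: "(\<lambda>x. f k l x *\<^sub>R k) differentiable at z" for k l z
    using df by auto
  have dw: "differentiable_field (\<lambda>x. wedge2 (f k l x *\<^sub>R k) l) z" for k l z
    using df by (auto simp: differentiable_field_def wedge2_def blinfun.scaleR_right)
  define f' where "f' k l = frechet_derivative (f k l) (at z)" for k l
  have hf: "(f k l has_derivative f' k l) (at z)" for k l
    using df by (simp add: f'_def frechet_derivative_works)
  have lb1: "lie_bracket (\<lambda>z. X *v z) (\<lambda>x. f k l x *\<^sub>R k) z = f' k l (X *v z) *\<^sub>R k - f k l z *\<^sub>R (X *v k)"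
    and lb2: "lie_bracket (\<lambda>z. X *v z) (\<lambda>x. l) z = - (X *v l)" for X :: "complex^'n^'n" and k l
  proof -
    have 1: "frechet_derivative (\<lambda>z. X *v z) (at z) = (\<lambda>z. X *v z)"
      by (rule frechet_derivative_at[symmetric], rule bounded_linear_imp_has_derivative)
        (simp add: linear_matrix_vector_right linear_conv_bounded_linear[symmetric])
    have 2: "frechet_derivative (\<lambda>x. f k l x *\<^sub>R k) (at z) = (\<lambda>v. f' k l v *\<^sub>R k)"
      by (rule frechet_derivative_at[symmetric]) (auto intro!: derivative_eq_intros hf)
    show "lie_bracket (\<lambda>z. X *v z) (\<lambda>x. f k l x *\<^sub>R k) z = f' k l (X *v z) *\<^sub>R k - f k l z *\<^sub>R (X *v k)"
      by (simp add: lie_bracket_def 1 2 linear_scale[OF linear_matrix_vector_right])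
    show "lie_bracket (\<lambda>z. X *v z) (\<lambda>x. l) z = - (X *v l)"
      by (simp add: lie_bracket_def 1)
  qed
  \<comment> \<open>The Lie derivative of the summand \<open>wedge2 (f k l z *\<^sub>R k) l\<close>,
    by the Leibniz rule and the brackets \<open>lb1\<close> and \<open>lb2\<close>.\<close>
  define L where "L X k l = (\<lambda>\<alpha> \<beta>. wedge2 (f' k l (X *v z) *\<^sub>R k - f k l z *\<^sub>R (X *v k)) l \<alpha> \<beta>
     - wedge2 (f k l z *\<^sub>R k) (X *v l) \<alpha> \<beta>)" for X :: "complex^'n^'n" and k l
  have L: "lie_deriv X \<Delta> z = (\<lambda>\<alpha> \<beta>. \<Sum>k\<in>Basis. \<Sum>l\<in>Basis. L X k l \<alpha> \<beta>)" for X
  proof (intro ext)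
    fix \<alpha> \<beta>
    have "((\<lambda>z. \<Delta> z \<alpha> \<beta>) has_derivative (\<lambda>v. \<Sum>k\<in>Basis. \<Sum>l\<in>Basis. f' k l v * wedge2 k l \<alpha> \<beta>)) (at z)"
      unfolding \<Delta>_eq wedge2_def blinfun.scaleR_right
      by (auto intro!: derivative_eq_intros hf simp: algebra_simps)
    then have "frechet_derivative (\<lambda>z. \<Delta> z \<alpha> \<beta>) (at z) = (\<lambda>v. \<Sum>k\<in>Basis. \<Sum>l\<in>Basis. f' k l v * wedge2 k l \<alpha> \<beta>)"
      by (rule frechet_derivative_at[symmetric])
    then show "lie_deriv X \<Delta> z \<alpha> \<beta> = (\<Sum>k\<in>Basis. \<Sum>l\<in>Basis. L X k l \<alpha> \<beta>)"
      unfolding lie_deriv_def L_def \<Delta>_eq wedge2_def pullcov_apply[OF linear_matrix_vector_right]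
      by (simp add: sum_subtractf[symmetric] blinfun.scaleR_right blinfun.diff_right
          linear_scale[OF linear_matrix_vector_right] algebra_simps del: sum_subtractf)
  qed
  have "schouten (\<lambda>z. wedge2 (X *v z) (Y *v z)) \<Delta> z \<alpha> \<beta> \<gamma> = (\<Sum>k\<in>Basis. \<Sum>l\<in>Basis.
      schouten (\<lambda>z. wedge2 (X *v z) (Y *v z)) (\<lambda>x. wedge2 (f k l x *\<^sub>R k) l) z \<alpha> \<beta> \<gamma>)"
  proof -
    have "differentiable_field (\<lambda>z. wedge2 (X *v z) (Y *v z)) z"
      by (intro bivector_field_imp_differentiable_field bivector_field_wedge2_linear linear_matrix_vector_right)
    then show ?thesis
      unfolding \<Delta>_eq[abs_def] by (simp add: schouten_sum_right dw differentiable_field_sum)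
  qed
  also have "\<dots> = (\<Sum>k\<in>Basis. \<Sum>l\<in>Basis. wedge12 (X *v z) (L Y k l) \<alpha> \<beta> \<gamma> - wedge12 (Y *v z) (L X k l) \<alpha> \<beta> \<gamma>)"
  proof (intro sum.cong refl)
    fix k l :: "complex^'n"
    have "schouten (\<lambda>z. wedge2 (X *v z) (Y *v z)) (\<lambda>x. wedge2 (f k l x *\<^sub>R k) l) z =
      schouten_dec (\<lambda>z. X *v z) (\<lambda>z. Y *v z) (\<lambda>x. f k l x *\<^sub>R k) (\<lambda>_. l) z"
      by (intro schouten_wedge2 matrix_vector_differentiable dfk) simp
    then show "schouten (\<lambda>z. wedge2 (X *v z) (Y *v z)) (\<lambda>x. wedge2 (f k l x *\<^sub>R k) l) z \<alpha> \<beta> \<gamma> =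
      wedge12 (X *v z) (L Y k l) \<alpha> \<beta> \<gamma> - wedge12 (Y *v z) (L X k l) \<alpha> \<beta> \<gamma>"
      unfolding schouten_dec_def lb1 lb2
      unfolding L_def schouten_rhs_def wedge3_def wedge12_def wedge2_def
      by (simp add: blinfun.minus_right blinfun.diff_right blinfun.scaleR_right algebra_simps)
  qed
  also have "\<dots> = wedge12 (X *v z) (lie_deriv Y \<Delta> z) \<alpha> \<beta> \<gamma> - wedge12 (Y *v z) (lie_deriv X \<Delta> z) \<alpha> \<beta> \<gamma>"
    unfolding L wedge12_sum sum_subtractf ..
  finally show ?thesis .
qed

lemma schouten_r_V_invariant:
  assumes r: "r \<in> wedge2_su" and \<Delta>: "bivector_field \<Delta>"
    and inv: "\<And>X z. X \<in> su \<Longrightarrow> lie_deriv X \<Delta> z = (\<lambda>_ _. 0)"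
  shows "schouten (r_V r) \<Delta> z \<alpha> \<beta> \<gamma> = 0"
proof -
  obtain N :: nat and X Y where su: "\<And>i. i < N \<Longrightarrow> X i \<in> su \<and> Y i \<in> su"
    and r: "r = (\<lambda>\<alpha> \<beta>. \<Sum>i<N. wedge2 (X i) (Y i) \<alpha> \<beta>)"
    using r by (auto simp: wedge2_su_def)
  have d: "differentiable_field (\<lambda>z. wedge2 (X i *v z) (Y i *v z)) z" for i z
    by (intro bivector_field_imp_differentiable_field bivector_field_wedge2_linear linear_matrix_vector_right)
  have "schouten (r_V r) \<Delta> z \<alpha> \<beta> \<gamma> =
     (\<Sum>i<N. schouten (\<lambda>z. wedge2 (X i *v z) (Y i *v z)) \<Delta> z \<alpha> \<beta> \<gamma>)"
    unfolding r r_V_sum_wedge2[abs_def]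
    by (simp add: schouten_sum_left d bivector_field_imp_differentiable_field[OF \<Delta>])
  also have "\<dots> = 0"
    by (intro sum.neutral ballI) (simp add: schouten_linear_wedge2_field[OF \<Delta>] inv su wedge12_def)
  finally show ?thesis .
qed

section \<open>Infinitesimal invariance\<close>

definition su2_block :: "'n \<Rightarrow> 'n \<Rightarrow> complex \<Rightarrow> complex \<Rightarrow> complex^'n^'n" where
  "su2_block j k a b = (\<chi> r s.
     if r = j then (if s = j then a else if s = k then b else 0)
     else if r = k then (if s = j then - cnj b else if s = k then cnj a else 0)
     else if s = r then 1 else 0)"

lemma sum_two_entries:
  fixes f :: "'n::finite \<Rightarrow> 'a::comm_ring_1"
  assumes "j \<noteq> k"
  shows "(\<Sum>m\<in>UNIV. (if m = j then x else if m = k then y else 0) * f m) = x * f j + y * f k"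
proof -
  have "(\<Sum>m\<in>UNIV. (if m = j then x else if m = k then y else 0) * f m) =
    (\<Sum>m\<in>{j, k}. (if m = j then x else if m = k then y else 0) * f m)"
    by (rule sum.mono_neutral_right) auto
  then show ?thesis using assms by simp
qed

lemma det_su2_block:
  fixes j k :: "'n::finite"
  assumes jk: "j \<noteq> k"
  shows "det (su2_block j k a b) = a * cnj a + b * cnj b"
proof -
  \<comment> \<open>The identity matrix with rows \<open>j\<close> and \<open>k\<close> replaced by
    \<open>u\<close> and \<open>w\<close>. Its determinant is an alternating bilinear form in the
    two rows, fixed by its value 1 at the standard rows.\<close>
  define M where "M u w = (\<chi> r. if r = j then u else if r = k then w else axis r 1)" for u w :: "complex^'n"
  have M1: "det (M (u + u') w) = det (M u w) + det (M u' w)" "det (M (c *s u) w) = c * det (M u w)" for u u' w c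
    using det_row_add[of j "\<lambda>_. u" "\<lambda>_. u'" "\<lambda>r. if r = k then w else axis r 1"]
      det_row_mul[of j c "\<lambda>_. u" "\<lambda>r. if r = k then w else axis r 1"] by (simp_all add: M_def)
  have Mk: "M u w = (\<chi> r. if r = k then w else if r = j then u else axis r 1)" for u w
    using jk by (auto simp: M_def vec_eq_iff)
  have M2: "det (M u (w + w')) = det (M u w) + det (M u w')" "det (M u (c *s w)) = c * det (M u w)" for u w w' c
    using det_row_add[of k "\<lambda>_. w" "\<lambda>_. w'" "\<lambda>r. if r = j then u else axis r 1"]
      det_row_mul[of k c "\<lambda>_. w" "\<lambda>r. if r = j then u else axis r 1"] by (simp_all add: Mk)
  have same: "det (M u u) = 0" for u
    by (rule det_identical_rows[OF jk]) (use jk in \<open>auto simp: M_def row_def vec_eq_iff\<close>)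
  have one: "det (M (axis j 1) (axis k 1)) = 1"
  proof -
    have "M (axis j 1) (axis k 1) = mat 1"
      by (auto simp: M_def vec_eq_iff mat_def axis_def)
    then show ?thesis by simp
  qed
  have swap: "det (M (axis k 1) (axis j 1)) = - 1"
  proof -
    have "det (M (axis j 1 + axis k 1) (axis j 1 + axis k 1)) = 1 + det (M (axis k 1) (axis j 1))"
      unfolding M1(1) M2(1) by (simp add: same one)
    then show ?thesis
      unfolding same by (simp add: add_eq_0_iff)
  qed
  have "su2_block j k a b = M (a *s axis j 1 + b *s axis k 1) ((- cnj b) *s axis j 1 + cnj a *s axis k 1)"
    using jk by (auto simp: su2_block_def M_def vec_eq_iff axis_def)
  then show ?thesis
    by (simp only: M1 M2 same one swap) (simp add: algebra_simps)
qed

lemma su2_block_SU: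
  fixes j k :: "'n::finite"
  assumes jk: "j \<noteq> k" and ab: "a * cnj a + b * cnj b = 1"
  shows "su2_block j k a b \<in> SU"
proof -
  have e: "(\<Sum>m\<in>UNIV. (if m = i then x else 0) * f m) = x * f i" for f :: "'n \<Rightarrow> complex" and i x
    by (simp add: if_distrib[of "\<lambda>x. x * _"] cong: if_cong)
  have "su2_block j k a b ** cadjoint (su2_block j k a b) = mat 1"
  proof -
    have "(\<Sum>m\<in>UNIV. su2_block j k a b $ r $ m * cnj (su2_block j k a b $ s $ m)) = (if r = s then 1 else 0)" for r s
    proof (cases "r = j")
      case True
      then show ?thesis
        using jk ab by (auto simp: su2_block_def sum_two_entries)
    next
      case rj: False
      show ?thesis
      proof (cases "r = k")
        case True
        then show ?thesis
          using jk ab by (auto simp: su2_block_def sum_two_entries mult.commute add.commute)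
      next
        case False
        then show ?thesis
          using rj by (auto simp: su2_block_def e)
      qed
    qed
    then show ?thesis
      by (simp add: vec_eq_iff matrix_matrix_mult_def cadjoint_nth mat_def)
  qed
  then show ?thesis
    using det_su2_block[OF jk, of a b] ab by (simp add: SU_def)
qed

text \<open>Invariance is differentiated at t = 0 along a curve in \<open>SU\<close> that starts at
  the identity with velocity \<open>X\<close>. When X X = -P for a projection P with P X = X, the
  curve is exp(tX). \<open>P\<close> leaves no trace, since \<open>cos t - 1\<close> vanishes to
  second order.\<close>

lemma lie_deriv_eq_0_curve:
  fixes X P :: "complex^'n^'n"
  assumes \<Delta>: "bivector_field \<Delta>" "SU_invariant_field \<Delta>"
    and SU: "\<And>t. mat 1 + (cos t - 1) *\<^sub>R P + sin t *\<^sub>R X \<in> SU"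
  shows "lie_deriv X \<Delta> z \<alpha> \<beta> = 0"
proof -
  define g where "g t = mat 1 + (cos t - 1) *\<^sub>R P + sin t *\<^sub>R X" for t
  have g: "g t *v v = v + (cos t - 1) *\<^sub>R (P *v v) + sin t *\<^sub>R (X *v v)" for t v
    by (simp add: g_def linear_add[OF linear_matrix_vector_left] linear_scale[OF linear_matrix_vector_left])
  have pull: "pullcov (\<lambda>v. g t *v v) \<delta> =
      \<delta> + (cos t - 1) *\<^sub>R pullcov (\<lambda>v. P *v v) \<delta> + sin t *\<^sub>R pullcov (\<lambda>v. X *v v) \<delta>" for t \<delta>
    by (rule blinfun_eqI, simp only: pullcov_apply[OF linear_matrix_vector_right] blinfun.add_left
        blinfun.scaleR_left) (simp add: g blinfun.add_right blinfun.scaleR_right)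
  have bl: "bilinear (\<Delta> z)"
    using \<Delta> by (simp add: bivector_field_def bivector_def)
  have g0: "g 0 *v z = z" by (simp add: g)
  let ?D = "frechet_derivative (\<lambda>z. \<Delta> z \<alpha> \<beta>) (at z)"
  let ?X = "pullcov (\<lambda>v. X *v v)" and ?P = "pullcov (\<lambda>v. P *v v)"
  have D: "((\<lambda>z. \<Delta> z \<alpha> \<beta>) has_derivative ?D) (at (g 0 *v z))"
    unfolding g0 using bivector_field_imp_differentiable_field[OF \<Delta>(1)]
    by (simp add: differentiable_field_def frechet_derivative_works)
  have "((\<lambda>t. g t *v z) has_derivative (\<lambda>t. t *\<^sub>R (X *v z))) (at 0)"
    unfolding g by (auto intro!: derivative_eq_intros)
  from has_derivative_compose[OF this D]
  have "((\<lambda>t. \<Delta> (g t *v z) \<alpha> \<beta>) has_derivative (\<lambda>t. ?D (t *\<^sub>R (X *v z)))) (at 0)"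
    by simp
  moreover have "?D (t *\<^sub>R v) = ?D v * t" for t v
    using linear_scale[OF has_derivative_linear[OF D]] by simp
  ultimately have 1: "((\<lambda>t. \<Delta> (g t *v z) \<alpha> \<beta>) has_real_derivative ?D (X *v z)) (at 0)"
    by (simp add: has_field_derivative_def)
  \<comment> \<open>The bilinear expansion: only the term with the single factor
    \<open>sin t\<close> has a nonzero derivative at 0.\<close>
  have "\<Delta> (g t *v z) \<alpha> \<beta> = \<Delta> z \<alpha> \<beta> + sin t * (\<Delta> z (?X \<alpha>) \<beta> + \<Delta> z \<alpha> (?X \<beta>))
      + (cos t - 1) * (\<Delta> z (?P \<alpha>) \<beta> + \<Delta> z \<alpha> (?P \<beta>)) + sin t * sin t * \<Delta> z (?X \<alpha>) (?X \<beta>)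
      + (cos t - 1) * (cos t - 1) * \<Delta> z (?P \<alpha>) (?P \<beta>)
      + (cos t - 1) * sin t * (\<Delta> z (?P \<alpha>) (?X \<beta>) + \<Delta> z (?X \<alpha>) (?P \<beta>))" for t
  proof -
    have "\<Delta> (g t *v z) = push2 (\<lambda>v. g t *v v) (\<Delta> z)"
      using \<Delta>(2) SU[of t] by (simp add: SU_invariant_field_def g_def)
    moreover have "\<Delta> z (\<alpha> + p *\<^sub>R A + q *\<^sub>R B) (\<beta> + p *\<^sub>R A' + q *\<^sub>R B') =
        \<Delta> z \<alpha> \<beta> + q * (\<Delta> z B \<beta> + \<Delta> z \<alpha> B') + p * (\<Delta> z A \<beta> + \<Delta> z \<alpha> A') + q * q * \<Delta> z B B'
        + p * p * \<Delta> z A A' + p * q * (\<Delta> z A B' + \<Delta> z B A')" for p q A A' B B'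
      by (simp add: bilinear_ladd[OF bl] bilinear_radd[OF bl] bilinear_lmul[OF bl]
          bilinear_rmul[OF bl] algebra_simps)
    ultimately show ?thesis
      by (simp only: push2_def pull)
  qed
  then have 2: "((\<lambda>t. \<Delta> (g t *v z) \<alpha> \<beta>) has_real_derivative (\<Delta> z (?X \<alpha>) \<beta> + \<Delta> z \<alpha> (?X \<beta>))) (at 0)"
    by (auto intro!: derivative_eq_intros)
  show ?thesis
    using DERIV_unique[OF 1 2] by (simp add: lie_deriv_def)
qed

section \<open>Generators of su(n)\<close>

definition su2_gen :: "'n \<Rightarrow> 'n \<Rightarrow> real \<Rightarrow> complex \<Rightarrow> complex^'n^'n" where
  "su2_gen j k s w = (\<chi> r c.
     if r = j then (if c = j then \<i> * of_real s else if c = k then w else 0)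
     else if r = k then (if c = j then - cnj w else if c = k then - (\<i> * of_real s) else 0)
     else 0)"

lemma scaleR_su2_gen: "c *\<^sub>R su2_gen j k s w = su2_gen j k (c * s) (c *\<^sub>R w)"
  unfolding vec_eq_iff vector_scaleR_component su2_gen_def vec_lambda_beta
  by (auto simp: scaleR_conv_of_real)

text \<open>The normalisation makes the 2x2 block square to minus the identity, so that its
  exponential is cos t + X sin t; \<open>a\<close> and \<open>b\<close> are the entries of its first
  row.\<close>

lemma lie_deriv_su2_gen_unit:
  assumes \<Delta>: "bivector_field \<Delta>" "SU_invariant_field \<Delta>"
    and jk: "j \<noteq> k" and sw: "of_real (s * s) + w * cnj w = 1"
  shows "lie_deriv (su2_gen j k s w) \<Delta> z \<alpha> \<beta> = 0"
proof (rule lie_deriv_eq_0_curve[OF \<Delta>])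
  fix t
  define a b where "a = of_real (cos t) + \<i> * of_real s * of_real (sin t)" and "b = w * of_real (sin t)"
  have "a * cnj a + b * cnj b = of_real (cos t * cos t) + (of_real (s * s) + w * cnj w) * of_real (sin t * sin t)"
    by (simp add: a_def b_def algebra_simps)
  also have "\<dots> = 1"
  proof -
    have "cos t * cos t + sin t * sin t = 1"
      using sin_cos_squared_add2[of t] by (simp add: power2_eq_square)
    then show ?thesis
      unfolding sw mult_1 of_real_add[symmetric] by simp
  qed
  finally have "su2_block j k a b \<in> SU"
    by (intro su2_block_SU jk)
  moreover have "mat 1 + (cos t - 1) *\<^sub>R (\<chi> r c. if r = c \<and> (r = j \<or> r = k) then 1 else 0) +
      sin t *\<^sub>R su2_gen j k s w = su2_block j k a b"
    unfolding scaleR_su2_gen vec_eq_iff vector_add_component vector_scaleR_component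
    using jk by (auto simp: mat_def su2_gen_def su2_block_def a_def b_def scaleR_conv_of_real)
  ultimately show "mat 1 + (cos t - 1) *\<^sub>R (\<chi> r c. if r = c \<and> (r = j \<or> r = k) then 1 else 0) +
      sin t *\<^sub>R su2_gen j k s w \<in> SU" by simp
qed

text \<open>Linearity in \<open>X\<close> extends the vanishing from normalised generators to their
  real span.\<close>

lemma subspace_lie_deriv_kernel:
  assumes \<Delta>: "bivector_field \<Delta>"
  shows "subspace {X. \<forall>z \<alpha> \<beta>. lie_deriv X \<Delta> z \<alpha> \<beta> = 0}"
proof -
  have bl: "bilinear (\<Delta> z)" for z
    using \<Delta> by (simp add: bivector_field_def bivector_def)
  have D: "linear (frechet_derivative (\<lambda>z. \<Delta> z \<alpha> \<beta>) (at z))" for z \<alpha> \<beta>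
    using bivector_field_imp_differentiable_field[OF \<Delta>]
    by (intro linear_frechet_derivative) (simp add: differentiable_field_def)
  have p: "pullcov (\<lambda>v. (X + Y) *v v) \<delta> = pullcov (\<lambda>v. X *v v) \<delta> + pullcov (\<lambda>v. Y *v v) \<delta>"
    "pullcov (\<lambda>v. (c *\<^sub>R X) *v v) \<delta> = c *\<^sub>R pullcov (\<lambda>v. X *v v) \<delta>" for X Y :: "complex^'n^'n" and c \<delta>
    by (rule blinfun_eqI, simp only: pullcov_apply[OF linear_matrix_vector_right] blinfun.add_left
        blinfun.scaleR_left, simp only: linear_add[OF linear_matrix_vector_left]
        linear_scale[OF linear_matrix_vector_left] blinfun.add_right blinfun.scaleR_right real_scaleR_def)+
  have add: "lie_deriv (X + Y) \<Delta> z \<alpha> \<beta> = lie_deriv X \<Delta> z \<alpha> \<beta> + lie_deriv Y \<Delta> z \<alpha> \<beta>" for X Y z \<alpha> \<beta>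
    unfolding lie_deriv_def p by (simp add: linear_add[OF linear_matrix_vector_left] linear_add[OF D]
        bilinear_ladd[OF bl] bilinear_radd[OF bl])
  have scale: "lie_deriv (c *\<^sub>R X) \<Delta> z \<alpha> \<beta> = c * lie_deriv X \<Delta> z \<alpha> \<beta>" for X c z \<alpha> \<beta>
    unfolding lie_deriv_def p by (simp add: linear_scale[OF linear_matrix_vector_left] linear_scale[OF D]
        bilinear_lmul[OF bl] bilinear_rmul[OF bl] algebra_simps)
  show ?thesis
    using scale[of 0 0] by (auto simp: subspace_def add scale)
qed

lemma lie_deriv_su:
  fixes X :: "complex^'n^'n"
  assumes \<Delta>: "bivector_field \<Delta>" "SU_invariant_field \<Delta>" and X: "X \<in> su"
  shows "lie_deriv X \<Delta> z = (\<lambda>_ _. 0)"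
proof -
  let ?S = "{X. \<forall>z \<alpha> \<beta>. lie_deriv X \<Delta> z \<alpha> \<beta> = 0}"
  note S = subspace_lie_deriv_kernel[OF \<Delta>(1)]
  have gen_w: "su2_gen j k 0 w \<in> ?S" if "j \<noteq> k" for j k w
  proof (cases "w = 0")
    case True
    then have "su2_gen j k 0 w = 0" by (simp add: vec_eq_iff su2_gen_def)
    then show ?thesis using subspace_0[OF S] by simp
  next
    case False
    have "su2_gen j k 0 (sgn w) \<in> ?S"
      using lie_deriv_su2_gen_unit[OF \<Delta> that, of 0 "sgn w"] False
      by (simp add: complex_norm_square[symmetric] norm_sgn)
    from subspace_scale[OF S this, of "norm w"] False
    show ?thesis
      unfolding scaleR_su2_gen by (simp add: sgn_div_norm)
  qed
  have gen_s: "su2_gen j k s 0 \<in> ?S" if "j \<noteq> k" for j k s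
  proof -
    have "su2_gen j k 1 0 \<in> ?S"
      using lie_deriv_su2_gen_unit[OF \<Delta> that, of 1 0] by simp
    from subspace_scale[OF S this, of s] show ?thesis
      unfolding scaleR_su2_gen by simp
  qed
  define o' :: 'n where "o' = undefined"
  \<comment> \<open>The off-diagonal part. Each pair of positions is hit by (j, k) and by (k, j),
    with the same result because \<open>X\<close> is skew-hermitian; hence the factor 1/2.\<close>
  define Y where "Y = (\<Sum>j\<in>UNIV. \<Sum>k\<in>UNIV - {j}. (1/2) *\<^sub>R su2_gen j k 0 (X $ j $ k))"
  \<comment> \<open>The diagonal part. The entry at the reference index \<open>o'\<close> is minus
    the sum of all the others, which is correct because the trace vanishes.\<close>
  define Z where "Z = (\<Sum>j\<in>UNIV - {o'}. su2_gen j o' (Im (X $ j $ j)) 0)"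
  have x: "cnj (X $ q $ p) = - X $ p $ q" for p q
    using X by (auto simp: su_def vec_eq_iff cadjoint_nth)
  have xd: "X $ p $ p = \<i> * of_real (Im (X $ p $ p))" for p
    using x[of p p] by (simp add: complex_eq_iff)
  have tr: "(\<Sum>p\<in>UNIV. X $ p $ p) = 0"
    using X by (simp add: su_def trace_def)
  have Y_nth: "Y $ p $ q = (if p = q then 0 else X $ p $ q)" for p q
  proof (cases "p = q")
    case True
    then show ?thesis by (auto simp: Y_def su2_gen_def intro!: sum.neutral split: if_splits)
  next
    case False
    have "Y $ p $ q = (\<Sum>j\<in>UNIV. \<Sum>k\<in>UNIV - {j}. (1/2) *\<^sub>R (if p = j \<and> q = k then X $ p $ q
        else if p = k \<and> q = j then X $ p $ q else 0))"
      unfolding Y_def using False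
      by (auto simp: su2_gen_def x intro!: sum.cong split: if_splits)
    also have "\<dots> = (\<Sum>(j,k)\<in>Sigma UNIV (\<lambda>j. UNIV - {j}). (1/2) *\<^sub>R (if p = j \<and> q = k then X $ p $ q
        else if p = k \<and> q = j then X $ p $ q else 0))"
      by (subst sum.Sigma) auto
    also have "\<dots> = (\<Sum>(j,k)\<in>{(p,q), (q,p)}. (1/2) *\<^sub>R (if p = j \<and> q = k then X $ p $ q
        else if p = k \<and> q = j then X $ p $ q else 0))"
      using False by (intro sum.mono_neutral_right) (auto split: if_splits)
    also have "\<dots> = X $ p $ q"
      using False by (simp add: scaleR_conv_of_real)
    finally show ?thesis using False by simp
  qed
  have Z_nth: "Z $ p $ q = (if p = q then X $ p $ p else 0)" for p q
  proof -
    have "Z $ p $ q = (\<Sum>j\<in>UNIV - {o'}. if p = q then (if p = j then X $ j $ j else if p = o' then - X $ j $ j else 0) else 0)"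
      unfolding Z_def sum_component
      by (intro sum.cong refl) (auto simp: su2_gen_def xd[symmetric])
    also have "\<dots> = (if p = q then X $ p $ p else 0)"
    proof (cases "p = o'")
      case True
      have "(\<Sum>j\<in>UNIV - {o'}. X $ j $ j) = - X $ o' $ o'"
        using tr by (subst (asm) sum.remove[of _ o']) (auto simp: add_eq_0_iff2 add_eq_0_iff)
      moreover have "(\<Sum>j\<in>UNIV - {o'}. if p = j then X $ j $ j else if p = o' then - X $ j $ j else 0) =
          - (\<Sum>j\<in>UNIV - {o'}. X $ j $ j)"
        unfolding sum_negf[symmetric] by (intro sum.cong refl) (use True in auto)
      ultimately show ?thesis using True by auto
    next
      case False
      have "(\<Sum>j\<in>UNIV - {o'}. if p = j then X $ j $ j else if p = o' then - X $ j $ j else 0) =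
          (\<Sum>j\<in>UNIV - {o'}. if p = j then X $ j $ j else 0)"
        by (intro sum.cong refl) (use False in auto)
      also have "\<dots> = X $ p $ p"
        using False by (simp add: sum.delta)
      finally show ?thesis
        by (cases "p = q") (simp_all only: if_True if_False sum.neutral_const simp_thms)
    qed
    finally show ?thesis .
  qed
  have "X = Y + Z"
    by (simp add: vec_eq_iff Y_nth Z_nth)
  moreover have "Y \<in> ?S"
    unfolding Y_def by (intro subspace_sum[OF S] subspace_scale[OF S] gen_w) auto
  moreover have "Z \<in> ?S"
    unfolding Z_def by (intro subspace_sum[OF S] gen_s) auto
  ultimately have "X \<in> ?S"
    using subspace_add[OF S] by blast
  then show ?thesis by (simp add: fun_eq_iff)
qed

section \<open>The Poisson action\<close>

lemma push2_push2:
  assumes "linear L" "linear M"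
  shows "push2 L (push2 M b) = push2 (L \<circ> M) b"
proof -
  have "pullcov M (pullcov L \<alpha>) = pullcov (L \<circ> M) \<alpha>" for \<alpha>
    using assms by (intro blinfun_eqI) (simp add: pullcov_apply linear_compose)
  then show ?thesis by (simp add: push2_def)
qed

text \<open>At \<open>z\<close> the right translate becomes X (g z) and the left one g (X z). So
  \<open>r_V r\<close> is a particular solution of the affine equation for pi_V, and \<Delta> has to
  solve the homogeneous equation, which is invariance.\<close>

lemma push2_pi_group:
  "push2 (\<lambda>X. X *v z) (pi_group r g) = (\<lambda>\<alpha> \<beta>. r_V r (g *v z) \<alpha> \<beta> - push2 (\<lambda>v. g *v v) (r_V r z) \<alpha> \<beta>)"
proof -
  have lin: "linear (\<lambda>X. X ** g)" "linear (\<lambda>X. g ** X)" for g :: "complex^'n^'n"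
    by (auto intro!: linearI simp: matrix_matrix_mult_def vec_eq_iff algebra_simps sum.distrib scaleR_sum_right)
  have "push2 (\<lambda>X. X *v z) (pi_group r g) = (\<lambda>\<alpha> \<beta>. push2 (\<lambda>X. X *v z) (push2 (\<lambda>X. X ** g) r) \<alpha> \<beta>
      - push2 (\<lambda>X. X *v z) (push2 (\<lambda>X. g ** X) r) \<alpha> \<beta>)"
    by (simp add: pi_group_def push2_def)
  then show ?thesis
    unfolding r_V_def push2_push2[OF linear_matrix_vector_left lin(1)] push2_push2[OF linear_matrix_vector_left lin(2)]
      push2_push2[OF linear_matrix_vector_right linear_matrix_vector_left]
    by (simp add: o_def matrix_vector_mul_assoc)
qed

lemma poisson_action_pi_group_iff:
  "poisson_action_SU (pi_group r) (\<lambda>z \<alpha> \<beta>. r_V r z \<alpha> \<beta> + \<Delta> z \<alpha> \<beta>) \<longleftrightarrow> SU_invariant_field \<Delta>"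
  unfolding poisson_action_SU_iff SU_invariant_field_def push2_pi_group fun_eq_iff
  by (simp add: push2_def)

lemma poisson_structure_r_V_add:
  assumes r: "r \<in> wedge2_su"
    and \<Delta>: "bivector_field \<Delta>" "SU_invariant_field \<Delta>"
  shows "poisson_structure (\<lambda>z \<alpha> \<beta>. r_V r z \<alpha> \<beta> + \<Delta> z \<alpha> \<beta>) \<longleftrightarrow>
    (\<forall>z \<alpha> \<beta> \<gamma>. schouten \<Delta> \<Delta> z \<alpha> \<beta> \<gamma> = - schouten (r_V r) (r_V r) z \<alpha> \<beta> \<gamma>)"
  using bivector_field_add[OF bivector_field_r_V[OF r] \<Delta>(1)]
    schouten_r_V_invariant[OF r \<Delta>(1) lie_deriv_su[OF \<Delta>]]
  unfolding poisson_structure_def fun_eq_iff schouten_add_add[OF bivector_field_r_V[OF r] \<Delta>(1)]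
  by (simp add: add_eq_0_iff)

theorem mainTheorem10:
  fixes r :: "(complex^'n^'n) bivec"
  assumes "CARD('n) \<ge> 2" and "classical_r_matrix r"
  shows "\<exists>c::real.
    (\<forall>z. schouten (r_V r) (r_V r) z
       = (\<lambda>\<alpha> \<beta> \<gamma>. - c * (norm z)\<^sup>2 * wedge12 (J z) pi0 \<alpha> \<beta> \<gamma>)) \<and>
    (\<forall>\<pi>\<^sub>V. poisson_structure \<pi>\<^sub>V \<and> poisson_action_SU (pi_group r) \<pi>\<^sub>V \<longleftrightarrow>
       (\<exists>\<Delta>. \<pi>\<^sub>V = (\<lambda>z \<alpha> \<beta>. r_V r z \<alpha> \<beta> + \<Delta> z \<alpha> \<beta>) \<and> bivector_field \<Delta> \<and> SU_invariant_field \<Delta> \<and>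
         (\<forall>z. schouten \<Delta> \<Delta> z = (\<lambda>\<alpha> \<beta> \<gamma>. c * (norm z)\<^sup>2 * wedge12 (J z) pi0 \<alpha> \<beta> \<gamma>))))"
proof -
  have r: "r \<in> wedge2_su"
    using assms(2) by (simp add: classical_r_matrix_def)
  obtain c where c: "\<And>z. schouten (r_V r) (r_V r) z
      = (\<lambda>\<alpha> \<beta> \<gamma>. - c * (norm z)\<^sup>2 * wedge12 (J z) pi0 \<alpha> \<beta> \<gamma>)"
    using schouten_r_V_eq[OF assms] by blast
  have iff: "poisson_structure (\<lambda>z \<alpha> \<beta>. r_V r z \<alpha> \<beta> + \<Delta> z \<alpha> \<beta>) \<longleftrightarrow>
      (\<forall>z. schouten \<Delta> \<Delta> z = (\<lambda>\<alpha> \<beta> \<gamma>. c * (norm z)\<^sup>2 * wedge12 (J z) pi0 \<alpha> \<beta> \<gamma>))"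
    if "bivector_field \<Delta>" "SU_invariant_field \<Delta>" for \<Delta>
    unfolding poisson_structure_r_V_add[OF r that] c fun_eq_iff by simp
  show ?thesis
  proof (rule exI[of _ c], rule conjI, rule allI, rule c, rule allI, rule iffI)
    fix \<pi>
    assume \<pi>: "poisson_structure \<pi> \<and> poisson_action_SU (pi_group r) \<pi>"
    define \<Delta> where "\<Delta> = (\<lambda>z \<alpha> \<beta>. \<pi> z \<alpha> \<beta> - r_V r z \<alpha> \<beta>)"
    have eq: "\<pi> = (\<lambda>z \<alpha> \<beta>. r_V r z \<alpha> \<beta> + \<Delta> z \<alpha> \<beta>)"
      by (simp add: \<Delta>_def)
    have bv: "bivector_field \<Delta>"
      using \<pi> unfolding \<Delta>_def poisson_structure_def
      by (intro bivector_field_diff bivector_field_r_V r) auto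
    have inv: "SU_invariant_field \<Delta>"
      using \<pi> unfolding eq poisson_action_pi_group_iff by simp
    show "\<exists>\<Delta>. \<pi> = (\<lambda>z \<alpha> \<beta>. r_V r z \<alpha> \<beta> + \<Delta> z \<alpha> \<beta>) \<and> bivector_field \<Delta> \<and> SU_invariant_field \<Delta> \<and>
         (\<forall>z. schouten \<Delta> \<Delta> z = (\<lambda>\<alpha> \<beta> \<gamma>. c * (norm z)\<^sup>2 * wedge12 (J z) pi0 \<alpha> \<beta> \<gamma>))"
      using \<pi> eq bv inv iff[OF bv inv] by auto
  next
    fix \<pi>
    assume "\<exists>\<Delta>. \<pi> = (\<lambda>z \<alpha> \<beta>. r_V r z \<alpha> \<beta> + \<Delta> z \<alpha> \<beta>) \<and> bivector_field \<Delta> \<and> SU_invariant_field \<Delta> \<and>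
         (\<forall>z. schouten \<Delta> \<Delta> z = (\<lambda>\<alpha> \<beta> \<gamma>. c * (norm z)\<^sup>2 * wedge12 (J z) pi0 \<alpha> \<beta> \<gamma>))"
    then obtain \<Delta> where \<Delta>: "\<pi> = (\<lambda>z \<alpha> \<beta>. r_V r z \<alpha> \<beta> + \<Delta> z \<alpha> \<beta>)" "bivector_field \<Delta>"
      "SU_invariant_field \<Delta>" "\<forall>z. schouten \<Delta> \<Delta> z = (\<lambda>\<alpha> \<beta> \<gamma>. c * (norm z)\<^sup>2 * wedge12 (J z) pi0 \<alpha> \<beta> \<gamma>)"
      by blast
    show "poisson_structure \<pi> \<and> poisson_action_SU (pi_group r) \<pi>"
      unfolding \<Delta>(1) poisson_action_pi_group_iff iff[OF \<Delta>(2,3)] using \<Delta>(3,4) by blast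
  qed
qed

end
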